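(* Let $q$ be a complex-valued potential that is bounded over its support, the support being assumed compact, and let $r=\kappa q^*$ with $\kappa\in\{+1,-1\}$. Fix $\zeta\in\mathbb{C}$ with $|\operatorname{Im}\zeta|<\infty$. If $\sum_{j=1}^s b_j=1$, then the integrating-factor (exponential) $s$-stage Runge-Kutta method with real coefficients $(A,\boldsymbol b,\boldsymbol c)$, written in one-step form as $$\boldsymbol v_{n+1}=e^{-i\zeta h\sigma_3}\bigl[\boldsymbol v_n+h\,\Lambda_{n+1}(t_n;h)\,\boldsymbol v_n\bigr],\qquad \Lambda_{n+1}(t_n;h)=\frac1h(\boldsymbol b^{\intercal}\otimes\sigma_0)\,D_n\,\bigl[I_{2s}-(A\otimes\sigma_0)D_n\bigr]^{-1}(\mathbf 1_s\otimes\sigma_0),$$ is convergent.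
   Context: The Zakharov-Shabat problem is $\boldsymbol v_t=-i\zeta\sigma_3\boldsymbol v+U(t)\boldsymbol v$ for $\boldsymbol v=(v_1,v_2)^{\intercal}$, with $\sigma_3=\mathrm{diag}(1,-1)$, $U_{11}=U_{22}=0$, $U_{12}=q(t)$, $U_{21}=r(t)=\kappa q^*(t)$. The method is obtained by applying the $s$-stage Runge-Kutta method with Butcher tableau $A=(a_{jk})\in\mathbb{R}^{s\times s}$, $\boldsymbol b=(b_1,\dots,b_s)^{\intercal}\in\mathbb{R}^s$, $\boldsymbol c=(c_1,\dots,c_s)$, $0\le c_1\le\dots\le c_s\le1$, to the equation satisfied by $\tilde{\boldsymbol v}=e^{i\sigma_3\zeta t}\boldsymbol v$, and then writing the result in terms of $\boldsymbol v_n=e^{-i\sigma_3\zeta t_n}\tilde{\boldsymbol v}_n$. Notation: $\sigma_0$ is the $2\times2$ identity, $I_{2s}$ the $2s\times2s$ identity, $\mathbf 1_s$ the column vector of $s$ ones, $\otimes$ the Kronecker product, and $D_n=\mathrm{diag}\bigl(h\,\mathcal U_{n+c_1},\dots,h\,\mathcal U_{n+c_s}\bigr)\in\mathbb{C}^{2s\times2s}$ (block diagonal) with $$h\,\mathcal U_{n+c_k}=\begin{pmatrix}0&h\,q(t_n+c_kh)\,e^{2i\zeta c_kh}\\ h\,r(t_n+c_kh)\,e^{-2i\zeta c_kh}&0\end{pmatrix}.$$ Convergence: let $[T_1,T_2]$ be a compact interval containing the support of $q$, $h=(T_2-T_1)/N$, $t_n=T_1+nh$ for $n=0,\dots,N$.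 The method is convergent if, for every initial vector $\boldsymbol v_0\in\mathbb{C}^2$, the numerical solution started from $\boldsymbol v_0$ is well defined for all sufficiently small $h$ and satisfies $\max_{0\le n\le N}\|\boldsymbol v_n-\boldsymbol v(t_n)\|\to0$ as $h\to0$, where $\boldsymbol v(t)$ is the exact solution of the Zakharov-Shabat problem on $[T_1,T_2]$ with $\boldsymbol v(T_1)=\boldsymbol v_0$.
   Formalization: The potential q is additionally assumed continuous almost everywhere; for merely bounded q the claim fails (q the indicator of the rationals in [0,1], ζ=0, forward Euler). The exact solution is taken in the Carathéodory sense. *)

theory Defs
  imports "HOL-Analysis.Analysis"
begin

text \<open>Kronecker product. The row index pair \<open>(i,k)\<close> plays the role of the block
  row \<open>i\<close> with inner row \<open>k\<close>, so \<open>complex^('s \<times> 2)^('s \<times> 2)\<close> stands for the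
  \<open>2s \<times> 2s\<close> matrices.\<close>

definition kron :: "'a::times^'n^'m \<Rightarrow> 'a^'q^'p \<Rightarrow> 'a^('n \<times> 'q)^('m \<times> 'p)" where
  "kron A B = (\<chi> i j. A $ fst i $ fst j * B $ snd i $ snd j)"

definition block_diag :: "('s::finite \<Rightarrow> 'a::zero^'q^'p) \<Rightarrow> 'a^('s \<times> 'q)^('s \<times> 'p)" where
  "block_diag B = (\<chi> i j. if fst i = fst j then B (fst i) $ snd i $ snd j else 0)"

text \<open>\<open>b\<^sup>T \<otimes> \<sigma>\<^sub>0\<close> has row index type \<open>1 \<times> 2\<close>, and \<open>1\<^sub>s \<otimes> \<sigma>\<^sub>0\<close> has
  column index type \<open>1 \<times> 2\<close>; this identifies \<open>1 \<times> 2\<close> with \<open>2\<close>.\<close>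

definition unblock :: "'a^(1 \<times> 2)^(1 \<times> 2) \<Rightarrow> 'a^2^2" where
  "unblock M = (\<chi> i j. M $ (1, i) $ (1, j))"

definition cvec :: "real^'n \<Rightarrow> complex^'n" where
  "cvec x = (\<chi> i. complex_of_real (x $ i))"

definition cmat :: "real^'n^'m \<Rightarrow> complex^'n^'m" where
  "cmat A = (\<chi> i j. complex_of_real (A $ i $ j))"

text \<open>Matrix exponential, by its power series (square matrices over \<open>complex\<close> do not form
  an instance of the type class of \<open>exp\<close>).\<close>

definition mexp :: "complex^'n^'n \<Rightarrow> complex^'n^'n" where
  "mexp M = (\<Sum>n. (((**) M) ^^ n) (mat 1) /\<^sub>R fact n)"

definition sigma0 :: "complex^2^2" where
  "sigma0 = mat 1"

definition sigma3 :: "complex^2^2" where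
  "sigma3 = vector [vector [1, 0], vector [0, -1]]"

definition potential_matrix :: "(real \<Rightarrow> complex) \<Rightarrow> (real \<Rightarrow> complex) \<Rightarrow> real \<Rightarrow> complex^2^2" where
  "potential_matrix q r t = vector [vector [0, q t], vector [r t, 0]]"

text \<open>\<open>mat c\<close> is \<open>c\<close> times the identity, so \<open>mat c ** M\<close> is the scalar multiple \<open>c M\<close>.\<close>

definition zs_matrix :: "complex \<Rightarrow> (real \<Rightarrow> complex) \<Rightarrow> (real \<Rightarrow> complex) \<Rightarrow> real \<Rightarrow> complex^2^2" where
  "zs_matrix \<zeta> q r t = mat (- \<i> * \<zeta>) ** sigma3 + potential_matrix q r t"

definition absolutely_continuous_on :: "real \<Rightarrow> real \<Rightarrow> (real \<Rightarrow> 'a::metric_space) \<Rightarrow> bool" where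
  "absolutely_continuous_on a b f \<longleftrightarrow>
    (\<forall>\<epsilon>>0. \<exists>\<delta>>0. \<forall>n (l :: nat \<Rightarrow> real) u.
      (\<forall>i<n. a \<le> l i \<and> l i \<le> u i \<and> u i \<le> b) \<and>
      (\<forall>i<n. \<forall>j<n. i \<noteq> j \<longrightarrow> {l i<..<u i} \<inter> {l j<..<u j} = {}) \<and>
      (\<Sum>i<n. u i - l i) < \<delta>
      \<longrightarrow> (\<Sum>i<n. dist (f (l i)) (f (u i))) < \<epsilon>)"

text \<open>Exact solutions are understood in the sense of Caratheodory, because the potential may
  be discontinuous (for instance at the end points of its support).\<close>

definition zs_solution ::
    "complex \<Rightarrow> (real \<Rightarrow> complex) \<Rightarrow> (real \<Rightarrow> complex) \<Rightarrow> real \<Rightarrow> real \<Rightarrow> complex^2 \<Rightarrow>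
     (real \<Rightarrow> complex^2) \<Rightarrow> bool" where
  "zs_solution \<zeta> q r T1 T2 v0 v \<longleftrightarrow>
    absolutely_continuous_on T1 T2 v \<and>
    (AE t in lebesgue. t \<in> {T1..T2} \<longrightarrow>
      (v has_vector_derivative (zs_matrix \<zeta> q r t *v v t)) (at t within {T1..T2})) \<and>
    v T1 = v0"

text \<open>The block \<open>h \<U>\<close> at a node \<open>t + c h\<close>.\<close>

definition node_block ::
    "complex \<Rightarrow> (real \<Rightarrow> complex) \<Rightarrow> (real \<Rightarrow> complex) \<Rightarrow> real \<Rightarrow> real \<Rightarrow> real \<Rightarrow> complex^2^2" where
  "node_block \<zeta> q r h t c = vector
    [vector [0, of_real h * q (t + c * h) * exp (2 * \<i> * \<zeta> * of_real (c * h))],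
     vector [of_real h * r (t + c * h) * exp (- 2 * \<i> * \<zeta> * of_real (c * h)), 0]]"

definition stage_matrix ::
    "real^'s \<Rightarrow> complex \<Rightarrow> (real \<Rightarrow> complex) \<Rightarrow> (real \<Rightarrow> complex) \<Rightarrow> real \<Rightarrow> real \<Rightarrow>
     complex^('s \<times> 2)^('s \<times> 2)" where
  "stage_matrix c \<zeta> q r h t = block_diag (\<lambda>k. node_block \<zeta> q r h t (c $ k))"

definition resolvent_matrix ::
    "real^'s^'s \<Rightarrow> real^'s \<Rightarrow> complex \<Rightarrow> (real \<Rightarrow> complex) \<Rightarrow> (real \<Rightarrow> complex) \<Rightarrow> real \<Rightarrow> real \<Rightarrow>
     complex^('s \<times> 2)^('s \<times> 2)" where
  "resolvent_matrix A c \<zeta> q r h t =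
    mat 1 - kron (cmat A) sigma0 ** stage_matrix c \<zeta> q r h t"

definition Lambda ::
    "real^'s^'s \<Rightarrow> real^'s \<Rightarrow> real^'s \<Rightarrow> complex \<Rightarrow> (real \<Rightarrow> complex) \<Rightarrow> (real \<Rightarrow> complex) \<Rightarrow>
     real \<Rightarrow> real \<Rightarrow> complex^2^2" where
  "Lambda A b c \<zeta> q r h t = (1 / h) *\<^sub>R unblock
    (kron (rowvector (cvec b)) sigma0 ** stage_matrix c \<zeta> q r h t
      ** matrix_inv (resolvent_matrix A c \<zeta> q r h t) ** kron (columnvector 1) sigma0)"

text \<open>The numerical solution with step size \<open>h\<close>, started at \<open>T1\<close>.\<close>

primrec numerical_solution ::
    "real^'s^'s \<Rightarrow> real^'s \<Rightarrow> real^'s \<Rightarrow> complex \<Rightarrow> (real \<Rightarrow> complex) \<Rightarrow> (real \<Rightarrow> complex) \<Rightarrow>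
     real \<Rightarrow> real \<Rightarrow> complex^2 \<Rightarrow> nat \<Rightarrow> complex^2" where
  "numerical_solution A b c \<zeta> q r T1 h v0 0 = v0"
| "numerical_solution A b c \<zeta> q r T1 h v0 (Suc n) =
    (let v = numerical_solution A b c \<zeta> q r T1 h v0 n
     in mexp (mat (- \<i> * \<zeta> * of_real h) ** sigma3)
          *v (v + h *\<^sub>R (Lambda A b c \<zeta> q r h (T1 + real n * h) *v v)))"

text \<open>\<open>matrix_inv\<close> is a junk value on singular matrices, so the existence of all the inverses
  used in the recursion has to be demanded separately.\<close>

definition method_well_defined ::
    "real^'s^'s \<Rightarrow> real^'s \<Rightarrow> complex \<Rightarrow> (real \<Rightarrow> complex) \<Rightarrow> (real \<Rightarrow> complex) \<Rightarrow>
     real \<Rightarrow> real \<Rightarrow> nat \<Rightarrow> bool" where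
  "method_well_defined A c \<zeta> q r T1 h N \<longleftrightarrow>
    (\<forall>n<N. invertible (resolvent_matrix A c \<zeta> q r h (T1 + real n * h)))"

text \<open>Convergence on \<open>[T1,T2]\<close>; the step size is \<open>h = (T2 - T1) / N\<close>, so \<open>h \<rightarrow> 0\<close> is \<open>N \<rightarrow> \<infinity>\<close>.
  Existence of the exact solution is part of the definition, so that the last conjunct is never
  vacuous.\<close>

definition method_convergent ::
    "real^'s^'s \<Rightarrow> real^'s \<Rightarrow> real^'s \<Rightarrow> complex \<Rightarrow> (real \<Rightarrow> complex) \<Rightarrow> (real \<Rightarrow> complex) \<Rightarrow>
     real \<Rightarrow> real \<Rightarrow> bool" where
  "method_convergent A b c \<zeta> q r T1 T2 \<longleftrightarrow>
    (\<forall>v0.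
      (\<forall>\<^sub>F N in sequentially. method_well_defined A c \<zeta> q r T1 ((T2 - T1) / real N) N) \<and>
      (\<exists>v. zs_solution \<zeta> q r T1 T2 v0 v) \<and>
      (\<forall>v. zs_solution \<zeta> q r T1 T2 v0 v \<longrightarrow>
        (\<lambda>N. let h = (T2 - T1) / real N in
           Max ((\<lambda>n. norm (numerical_solution A b c \<zeta> q r T1 h v0 n - v (T1 + real n * h))) ` {0..N}))
        \<longlonglongrightarrow> 0))"

definition function_support :: "(real \<Rightarrow> complex) \<Rightarrow> real set" where
  "function_support q = closure {t. q t \<noteq> 0}"

end

theory Submission
  imports Defs
begin

text \<open>
  The one-step map and the exact flow are compared directly for \<open>v\<close>, without passing to
  \<open>exp (i \<sigma>\<^sub>3 \<zeta> t) v\<close>. Write \<open>Z = -i \<zeta> \<sigma>\<^sub>3\<close> and \<open>U(t)\<close> for the potential matrix. For small \<open>h\<close> the stage matrix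
  \<open>D\<^sub>n\<close> is \<open>O(h)\<close>, so \<open>1 - (A \<otimes> \<sigma>\<^sub>0) D\<^sub>n\<close> is invertible, its inverse is \<open>1 + O(h)\<close>, and one step of
  the method multiplies by
  \<open>1 + h (Z + (\<Sum>k. b\<^sub>k U(t\<^sub>n + c\<^sub>k h))) + O(h\<^sup>2)\<close>, uniformly in \<open>t\<^sub>n\<close>
  (\<open>one_step_matrix_expansion\<close>).

  On the other side, an exact solution is absolutely continuous with \<open>v' = (Z + U) v\<close> almost
  everywhere. Since \<open>\<Sum>k. b\<^sub>k = 1\<close>, the matrices \<open>U(t)\<close> and \<open>\<Sum>k. b\<^sub>k U(t\<^sub>n + c\<^sub>k h)\<close> differ on
  \<open>[t\<^sub>n, t\<^sub>n + h]\<close> by at most a constant times the oscillation of \<open>q\<close> on that interval. A mean value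
  inequality for absolutely continuous functions then bounds the local error by
  \<open>const * (osc\<^sub>n + h) * h\<close>; it replaces the fundamental theorem of calculus
  (\<open>caratheodory_linear_step\<close>).

  Without smoothness of the potential there is no rate of convergence; but the discrete Gronwall
  inequality only needs the local errors to have a small sum, and \<open>\<Sum>n. h * osc\<^sub>n\<close> tends to \<open>0\<close> because a
  bounded, almost everywhere continuous function is Riemann integrable
  (\<open>riemann_oscillation_sum_tendsto_0\<close>).

  The exact solution itself comes from the Banach fixed point theorem applied to the integral equation
  (\<open>caratheodory_solution_exists\<close>). The error bound applies to every solution,
  so all of them agree with the limit of the numerical ones.
\<close>

section \<open>Absolutely continuous functions\<close>

lemma absolutely_continuous_onE:
  assumes "absolutely_continuous_on a b f" "0 < \<epsilon>"
  obtains \<delta> where "0 < \<delta>"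
    "\<And>n (l :: nat \<Rightarrow> real) u.
      (\<And>i. i < n \<Longrightarrow> a \<le> l i \<and> l i \<le> u i \<and> u i \<le> b) \<Longrightarrow>
      (\<And>i j. i < n \<Longrightarrow> j < n \<Longrightarrow> i \<noteq> j \<Longrightarrow> {l i<..<u i} \<inter> {l j<..<u j} = {}) \<Longrightarrow>
      (\<Sum>i<n. u i - l i) < \<delta> \<Longrightarrow> (\<Sum>i<n. dist (f (l i)) (f (u i))) < \<epsilon>"
proof -
  obtain \<delta> where "0 < \<delta>" and \<delta>: "\<forall>n (l :: nat \<Rightarrow> real) u.
      (\<forall>i<n. a \<le> l i \<and> l i \<le> u i \<and> u i \<le> b) \<and>
      (\<forall>i<n. \<forall>j<n. i \<noteq> j \<longrightarrow> {l i<..<u i} \<inter> {l j<..<u j} = {}) \<and>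
      (\<Sum>i<n. u i - l i) < \<delta> \<longrightarrow> (\<Sum>i<n. dist (f (l i)) (f (u i))) < \<epsilon>"
    using assms unfolding absolutely_continuous_on_def by (elim allE[of _ \<epsilon>]) iprover
  show thesis
    by (rule that[OF \<open>0 < \<delta>\<close> \<delta>[THEN spec, THEN spec, THEN spec, THEN mp]]) auto
qed

lemma absolutely_continuous_onI:
  assumes "\<And>\<epsilon>. 0 < \<epsilon> \<Longrightarrow> \<exists>\<delta>>0. \<forall>n (l :: nat \<Rightarrow> real) u.
      (\<forall>i<n. a \<le> l i \<and> l i \<le> u i \<and> u i \<le> b) \<longrightarrow>
      (\<forall>i<n. \<forall>j<n. i \<noteq> j \<longrightarrow> {l i<..<u i} \<inter> {l j<..<u j} = {}) \<longrightarrow>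
      (\<Sum>i<n. u i - l i) < \<delta> \<longrightarrow> (\<Sum>i<n. dist (f (l i)) (f (u i))) < \<epsilon>"
  shows "absolutely_continuous_on a b f"
  unfolding absolutely_continuous_on_def using assms by (simp only: imp_conjL) simp

lemma absolutely_continuous_on_lipschitz:
  fixes f :: "real \<Rightarrow> 'a::metric_space"
  assumes lip: "\<And>x y. a \<le> x \<Longrightarrow> x \<le> y \<Longrightarrow> y \<le> b \<Longrightarrow> dist (f x) (f y) \<le> C * (y - x)"
  shows "absolutely_continuous_on a b f"
proof (rule absolutely_continuous_onI)
  fix \<epsilon> :: real assume "0 < \<epsilon>"
  show "\<exists>\<delta>>0. \<forall>n (l :: nat \<Rightarrow> real) u.
      (\<forall>i<n. a \<le> l i \<and> l i \<le> u i \<and> u i \<le> b) \<longrightarrow>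
      (\<forall>i<n. \<forall>j<n. i \<noteq> j \<longrightarrow> {l i<..<u i} \<inter> {l j<..<u j} = {}) \<longrightarrow>
      (\<Sum>i<n. u i - l i) < \<delta> \<longrightarrow> (\<Sum>i<n. dist (f (l i)) (f (u i))) < \<epsilon>"
  proof (intro exI[of _ "\<epsilon> / (\<bar>C\<bar> + 1)"] conjI allI impI)
    fix n and l u :: "nat \<Rightarrow> real"
    assume lu: "\<forall>i<n. a \<le> l i \<and> l i \<le> u i \<and> u i \<le> b" and small: "(\<Sum>i<n. u i - l i) < \<epsilon> / (\<bar>C\<bar> + 1)"
    have "(\<Sum>i<n. dist (f (l i)) (f (u i))) \<le> (\<Sum>i<n. (\<bar>C\<bar> + 1) * (u i - l i))"
    proof (rule sum_mono)
      fix i assume "i \<in> {..<n}"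
      with lu have i: "a \<le> l i" "l i \<le> u i" "u i \<le> b" by auto
      have "dist (f (l i)) (f (u i)) \<le> C * (u i - l i)" by (rule lip[OF i])
      also have "\<dots> \<le> (\<bar>C\<bar> + 1) * (u i - l i)" using i by (intro mult_right_mono) auto
      finally show "dist (f (l i)) (f (u i)) \<le> (\<bar>C\<bar> + 1) * (u i - l i)" .
    qed
    also have "\<dots> = (\<bar>C\<bar> + 1) * (\<Sum>i<n. u i - l i)" by (simp add: sum_distrib_left)
    also have "\<dots> < \<epsilon>" using small by (simp add: pos_less_divide_eq mult.commute)
    finally show "(\<Sum>i<n. dist (f (l i)) (f (u i))) < \<epsilon>" .
  qed (use \<open>0 < \<epsilon>\<close> in auto)
qed

lemma absolutely_continuous_on_subset:
  assumes "absolutely_continuous_on a b f" "a \<le> c" "d \<le> b"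
  shows "absolutely_continuous_on c d f"
proof (rule absolutely_continuous_onI)
  fix \<epsilon> :: real assume "0 < \<epsilon>"
  then obtain \<delta> where "0 < \<delta>" and \<delta>: "\<And>n (l :: nat \<Rightarrow> real) u.
      (\<And>i. i < n \<Longrightarrow> a \<le> l i \<and> l i \<le> u i \<and> u i \<le> b) \<Longrightarrow>
      (\<And>i j. i < n \<Longrightarrow> j < n \<Longrightarrow> i \<noteq> j \<Longrightarrow> {l i<..<u i} \<inter> {l j<..<u j} = {}) \<Longrightarrow>
      (\<Sum>i<n. u i - l i) < \<delta> \<Longrightarrow> (\<Sum>i<n. dist (f (l i)) (f (u i))) < \<epsilon>"
    using absolutely_continuous_onE[OF assms(1)] by blast
  show "\<exists>\<delta>>0. \<forall>n (l :: nat \<Rightarrow> real) u.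
      (\<forall>i<n. c \<le> l i \<and> l i \<le> u i \<and> u i \<le> d) \<longrightarrow>
      (\<forall>i<n. \<forall>j<n. i \<noteq> j \<longrightarrow> {l i<..<u i} \<inter> {l j<..<u j} = {}) \<longrightarrow>
      (\<Sum>i<n. u i - l i) < \<delta> \<longrightarrow> (\<Sum>i<n. dist (f (l i)) (f (u i))) < \<epsilon>"
    by (intro exI[of _ \<delta>] conjI allI impI \<delta> \<open>0 < \<delta>\<close>) (use assms(2,3) in \<open>auto intro: order_trans\<close>)
qed

lemma absolutely_continuous_on_diff:
  fixes f g :: "real \<Rightarrow> 'a::real_normed_vector"
  assumes "absolutely_continuous_on a b f" "absolutely_continuous_on a b g"
  shows "absolutely_continuous_on a b (\<lambda>t. f t - g t)"
proof (rule absolutely_continuous_onI)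
  fix \<epsilon> :: real assume "0 < \<epsilon>"
  then have "0 < \<epsilon> / 2" by simp
  obtain \<delta>1 where "0 < \<delta>1" and \<delta>1: "\<And>n (l :: nat \<Rightarrow> real) u.
      (\<And>i. i < n \<Longrightarrow> a \<le> l i \<and> l i \<le> u i \<and> u i \<le> b) \<Longrightarrow>
      (\<And>i j. i < n \<Longrightarrow> j < n \<Longrightarrow> i \<noteq> j \<Longrightarrow> {l i<..<u i} \<inter> {l j<..<u j} = {}) \<Longrightarrow>
      (\<Sum>i<n. u i - l i) < \<delta>1 \<Longrightarrow> (\<Sum>i<n. dist (f (l i)) (f (u i))) < \<epsilon> / 2"
    using absolutely_continuous_onE[OF assms(1) \<open>0 < \<epsilon> / 2\<close>] by blast
  obtain \<delta>2 where "0 < \<delta>2" and \<delta>2: "\<And>n (l :: nat \<Rightarrow> real) u.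
      (\<And>i. i < n \<Longrightarrow> a \<le> l i \<and> l i \<le> u i \<and> u i \<le> b) \<Longrightarrow>
      (\<And>i j. i < n \<Longrightarrow> j < n \<Longrightarrow> i \<noteq> j \<Longrightarrow> {l i<..<u i} \<inter> {l j<..<u j} = {}) \<Longrightarrow>
      (\<Sum>i<n. u i - l i) < \<delta>2 \<Longrightarrow> (\<Sum>i<n. dist (g (l i)) (g (u i))) < \<epsilon> / 2"
    using absolutely_continuous_onE[OF assms(2) \<open>0 < \<epsilon> / 2\<close>] by blast
  show "\<exists>\<delta>>0. \<forall>n (l :: nat \<Rightarrow> real) u.
      (\<forall>i<n. a \<le> l i \<and> l i \<le> u i \<and> u i \<le> b) \<longrightarrow>
      (\<forall>i<n. \<forall>j<n. i \<noteq> j \<longrightarrow> {l i<..<u i} \<inter> {l j<..<u j} = {}) \<longrightarrow>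
      (\<Sum>i<n. u i - l i) < \<delta> \<longrightarrow> (\<Sum>i<n. dist (f (l i) - g (l i)) (f (u i) - g (u i))) < \<epsilon>"
  proof (intro exI[of _ "min \<delta>1 \<delta>2"] conjI allI impI)
    fix n and l u :: "nat \<Rightarrow> real"
    assume *: "\<forall>i<n. a \<le> l i \<and> l i \<le> u i \<and> u i \<le> b"
      "\<forall>i<n. \<forall>j<n. i \<noteq> j \<longrightarrow> {l i<..<u i} \<inter> {l j<..<u j} = {}" and "(\<Sum>i<n. u i - l i) < min \<delta>1 \<delta>2"
    then have s: "(\<Sum>i<n. u i - l i) < \<delta>1" "(\<Sum>i<n. u i - l i) < \<delta>2" by simp_all
    have "(\<Sum>i<n. dist (f (l i) - g (l i)) (f (u i) - g (u i)))
        \<le> (\<Sum>i<n. dist (f (l i)) (f (u i))) + (\<Sum>i<n. dist (g (l i)) (g (u i)))"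
      unfolding sum.distrib[symmetric]
    proof (rule sum_mono)
      fix i
      have "f (l i) - g (l i) - (f (u i) - g (u i)) = (f (l i) - f (u i)) - (g (l i) - g (u i))"
        by simp
      then show "dist (f (l i) - g (l i)) (f (u i) - g (u i)) \<le> dist (f (l i)) (f (u i)) + dist (g (l i)) (g (u i))"
        unfolding dist_norm by (metis norm_triangle_ineq4)
    qed
    also have "\<dots> < \<epsilon> / 2 + \<epsilon> / 2"
    proof (rule add_strict_mono)
      show "(\<Sum>i<n. dist (f (l i)) (f (u i))) < \<epsilon> / 2" by (rule \<delta>1) (use * s in auto)
      show "(\<Sum>i<n. dist (g (l i)) (g (u i))) < \<epsilon> / 2" by (rule \<delta>2) (use * s in auto)
    qed
    finally show "(\<Sum>i<n. dist (f (l i) - g (l i)) (f (u i) - g (u i))) < \<epsilon>" by simp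
  qed (use \<open>0 < \<delta>1\<close> \<open>0 < \<delta>2\<close> in simp)
qed

lemma absolutely_continuous_on_imp_continuous_on:
  fixes f :: "real \<Rightarrow> 'a::metric_space"
  assumes "absolutely_continuous_on a b f"
  shows "continuous_on {a..b} f"
  unfolding continuous_on_iff
proof (intro ballI allI impI)
  fix x and \<epsilon> :: real assume x: "x \<in> {a..b}" and "0 < \<epsilon>"
  then obtain \<delta> where "0 < \<delta>" and \<delta>: "\<And>n (l :: nat \<Rightarrow> real) u.
      (\<And>i. i < n \<Longrightarrow> a \<le> l i \<and> l i \<le> u i \<and> u i \<le> b) \<Longrightarrow>
      (\<And>i j. i < n \<Longrightarrow> j < n \<Longrightarrow> i \<noteq> j \<Longrightarrow> {l i<..<u i} \<inter> {l j<..<u j} = {}) \<Longrightarrow>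
      (\<Sum>i<n. u i - l i) < \<delta> \<Longrightarrow> (\<Sum>i<n. dist (f (l i)) (f (u i))) < \<epsilon>"
    using absolutely_continuous_onE[OF assms] by blast
  have one: "dist (f l) (f u) < \<epsilon>" if "a \<le> l" "l \<le> u" "u \<le> b" "u - l < \<delta>" for l u
    using that \<delta>[of 1 "\<lambda>_. l" "\<lambda>_. u"] by simp
  have "dist (f y) (f x) < \<epsilon>" if "y \<in> {a..b}" "dist y x < \<delta>" for y
    using one[of x y] one[of y x] x that
    by (cases "x \<le> y") (auto simp: dist_commute dist_real_def)
  with \<open>0 < \<delta>\<close> show "\<exists>d>0. \<forall>y\<in>{a..b}. dist y x < d \<longrightarrow> dist (f y) (f x) < \<epsilon>" by blast
qed

text \<open>Transfers the \<open>\<epsilon>\<close>-\<open>\<delta>\<close> condition from indexed families of intervals to tagged partial divisions, the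
  form in which a gauge argument produces them.\<close>

lemma sum_dist_less_of_absolutely_continuous:
  fixes f :: "real \<Rightarrow> 'a::metric_space"
  assumes ac: "\<And>n (l :: nat \<Rightarrow> real) u.
      (\<And>i. i < n \<Longrightarrow> a \<le> l i \<and> l i \<le> u i \<and> u i \<le> b) \<Longrightarrow>
      (\<And>i j. i < n \<Longrightarrow> j < n \<Longrightarrow> i \<noteq> j \<Longrightarrow> {l i<..<u i} \<inter> {l j<..<u j} = {}) \<Longrightarrow>
      (\<Sum>i<n. u i - l i) < \<delta> \<Longrightarrow> (\<Sum>i<n. dist (f (l i)) (f (u i))) < \<epsilon>"
    and p: "p tagged_partial_division_of {a..b}"
    and small: "(\<Sum>(x,K)\<in>p. Sup K - Inf K) < \<delta>"
  shows "(\<Sum>(x,K)\<in>p. dist (f (Inf K)) (f (Sup K))) < \<epsilon>"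
proof -
  note pD = tagged_partial_division_ofD[OF p]
  obtain g where g: "bij_betw g {..<card p} p"
    using ex_bij_betw_nat_finite[OF pD(1)] by (auto simp: atLeast0LessThan)
  define l u where "l i = Inf (snd (g i))" and "u i = Sup (snd (g i))" for i
  have K: "\<exists>x. (x, {l i..u i}) = g i \<and> a \<le> l i \<and> l i \<le> u i \<and> u i \<le> b" if "i < card p" for i
  proof -
    obtain x K where gi: "g i = (x, K)" by (cases "g i")
    with g that have xK: "(x, K) \<in> p" by (metis bij_betwE lessThan_iff)
    obtain c d where cd: "K = {c..d}" using pD(4)[OF xK] by auto
    with pD(2)[OF xK] pD(3)[OF xK] have "c \<le> d" "a \<le> c" "d \<le> b" by auto
    with cd gi show ?thesis by (auto simp: l_def u_def)
  qed
  have reindex: "(\<Sum>(x,K)\<in>p. h (Inf K) (Sup K)) = (\<Sum>i<card p. h (l i) (u i))" for h :: "real \<Rightarrow> real \<Rightarrow> real"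
    unfolding sum.reindex_bij_betw[OF g, symmetric] l_def u_def by (simp add: case_prod_beta)
  have "(\<Sum>i<card p. dist (f (l i)) (f (u i))) < \<epsilon>"
  proof (rule ac)
    fix i j assume ij: "i < card p" "j < card p" "i \<noteq> j"
    obtain x y where xy: "(x, {l i..u i}) = g i" "(y, {l j..u j}) = g j"
      using K[OF ij(1)] K[OF ij(2)] by auto
    have "g i \<noteq> g j" "g i \<in> p" "g j \<in> p"
      using g ij by (auto simp: bij_betw_def inj_on_def)
    then show "{l i<..<u i} \<inter> {l j<..<u j} = {}"
      using pD(5)[of x "{l i..u i}" y "{l j..u j}"] xy by (auto simp: interior_atLeastAtMost_real)
  qed (use K small reindex[of "\<lambda>x y. y - x"] in auto)
  then show ?thesis using reindex[of "\<lambda>x y. dist (f x) (f y)"] by simp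
qed

lemma sum_lengths_le_measure:
  assumes p: "p tagged_partial_division_of {a..b::real}"
    and sub: "\<And>x K. (x, K) \<in> p \<Longrightarrow> K \<subseteq> G" and G: "G \<in> lmeasurable"
  shows "(\<Sum>(x,K)\<in>p. Sup K - Inf K) \<le> measure lebesgue G"
proof -
  note pD = tagged_partial_division_ofD[OF p]
  have int: "\<exists>c d. K = {c..d} \<and> c \<le> d" if "(x, K) \<in> p" for x K
    using pD(2)[OF that] pD(4)[OF that] by fastforce
  have "(\<Sum>(x,K)\<in>p. Sup K - Inf K) = (\<Sum>z\<in>p. measure lebesgue (interior (snd z)))"
    by (rule sum.cong) (use int in \<open>force simp: interior_atLeastAtMost_real\<close>)+
  also have "\<dots> = measure lebesgue (\<Union>z\<in>p. interior (snd z))"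
  proof (rule measure_finite_Union[symmetric])
    show "disjoint_family_on (\<lambda>z. interior (snd z)) p"
      unfolding disjoint_family_on_def
    proof (intro ballI impI)
      fix y z assume "y \<in> p" "z \<in> p" "y \<noteq> z"
      then show "interior (snd y) \<inter> interior (snd z) = {}"
        using pD(5)[of "fst y" "snd y" "fst z" "snd z"] by (simp add: prod_eq_iff)
    qed
    show "emeasure lebesgue (interior (snd z)) \<noteq> \<infinity>" if "z \<in> p" for z
      using int[of "fst z" "snd z"] that by (auto simp: interior_atLeastAtMost_real)
  qed (use pD(1) in auto)
  also have "\<dots> \<le> measure lebesgue G"
  proof (rule measure_mono_fmeasurable[OF _ _ G])
    show "(\<Union>z\<in>p. interior (snd z)) \<subseteq> G"
      using sub interior_subset by fastforce
    show "(\<Union>z\<in>p. interior (snd z)) \<in> sets lebesgue"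
      using pD(1) by (intro sets.finite_UN) auto
  qed
  finally show ?thesis .
qed

text \<open>Cousin's lemma gives a tagged division that is fine for a gauge chosen as follows. At a tag where the
  derivative exists, the increment of \<open>f\<close> over a small interval is at most \<open>(B + \<epsilon>)\<close> times its length.
  The remaining tags lie in a null set; their intervals are forced into an open set of tiny measure,
  where absolute continuity makes the total increment less than \<open>\<epsilon>\<close>.\<close>

theorem absolutely_continuous_mean_value_bound:
  fixes f :: "real \<Rightarrow> 'a::real_normed_vector"
  assumes ab: "a \<le> b" and ac: "absolutely_continuous_on a b f" and "0 \<le> B"
    and der: "AE t in lebesgue. t \<in> {a..b} \<longrightarrow>
      (\<exists>D. (f has_vector_derivative D) (at t within {a..b}) \<and> norm D \<le> B)"
  shows "norm (f b - f a) \<le> B * (b - a)"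
proof (rule field_le_epsilon)
  fix e :: real assume "0 < e"
  \<comment> \<open>The good tags cost \<open>\<epsilon> (b - a)\<close> and the bad ones \<open>\<epsilon>\<close>, together exactly \<open>e\<close>.\<close>
  define \<epsilon> where "\<epsilon> = e / (b - a + 1)"
  have \<epsilon>: "0 < \<epsilon>" "\<epsilon> * (b - a) + \<epsilon> = e"
    using \<open>0 < e\<close> ab by (simp_all add: \<epsilon>_def divide_simps) (simp add: algebra_simps)
  obtain N where N: "N \<in> null_sets lebesgue"
    and good: "\<And>t. t \<in> {a..b} - N \<Longrightarrow>
      \<exists>D. (f has_vector_derivative D) (at t within {a..b}) \<and> norm D \<le> B"
  proof -
    obtain N where "N \<in> null_sets lebesgue" and "{t \<in> space lebesgue. \<not> (t \<in> {a..b} \<longrightarrow>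
        (\<exists>D. (f has_vector_derivative D) (at t within {a..b}) \<and> norm D \<le> B))} \<subseteq> N"
      using der unfolding eventually_ae_filter by blast
    then show thesis by (intro that[of N]) auto
  qed
  obtain \<delta> where "0 < \<delta>" and \<delta>: "\<And>n (l :: nat \<Rightarrow> real) u.
      (\<And>i. i < n \<Longrightarrow> a \<le> l i \<and> l i \<le> u i \<and> u i \<le> b) \<Longrightarrow>
      (\<And>i j. i < n \<Longrightarrow> j < n \<Longrightarrow> i \<noteq> j \<Longrightarrow> {l i<..<u i} \<inter> {l j<..<u j} = {}) \<Longrightarrow>
      (\<Sum>i<n. u i - l i) < \<delta> \<Longrightarrow> (\<Sum>i<n. dist (f (l i)) (f (u i))) < \<epsilon>"
    using absolutely_continuous_onE[OF ac \<epsilon>(1)] by blast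
  obtain G where G: "open G" "N \<subseteq> G" "G - N \<in> lmeasurable" "emeasure lebesgue (G - N) < ennreal \<delta>"
    using sets_lebesgue_outer_open[of N \<delta>] N \<open>0 < \<delta>\<close> by auto
  have Gm: "G \<in> lmeasurable" "measure lebesgue G < \<delta>"
  proof -
    have "G = (G - N) \<union> N" using G(2) by auto
    moreover have "N \<in> lmeasurable" using N by (simp add: negligible_iff_null_sets[symmetric] negligible_imp_measurable)
    ultimately show m: "G \<in> lmeasurable" using G(3) by (metis fmeasurable.Un)
    have "measure lebesgue G = measure lebesgue (G - N)"
      using N m by (simp add: measure_Diff_null_set fmeasurableD)
    also have "\<dots> < \<delta>" using G(3,4) \<open>0 < \<delta>\<close> by (simp add: emeasure_eq_measure2 ennreal_less_iff)
    finally show "measure lebesgue G < \<delta>" .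
  qed
  \<comment> \<open>The straddle estimate at good tags; bad tags stay inside \<open>G\<close>.\<close>
  have "\<exists>d>0. (x \<in> N \<longrightarrow> ball x d \<subseteq> G) \<and> (x \<in> {a..b} - N \<longrightarrow>
      (\<forall>u v. a \<le> u \<and> u \<le> x \<and> x \<le> v \<and> v \<le> b \<and> {u..v} \<subseteq> ball x d
        \<longrightarrow> norm (f v - f u) \<le> (B + \<epsilon>) * (v - u)))" for x
  proof (cases "x \<in> {a..b} - N")
    case True
    then obtain D where D: "(f has_vector_derivative D) (at x within {a..b})" "norm D \<le> B"
      using good by blast
    from D(1) \<epsilon>(1) obtain d where "0 < d" and d: "\<And>y. y \<in> {a..b} \<Longrightarrow> \<bar>y - x\<bar> < d \<Longrightarrow>
        norm (f y - f x - (y - x) *\<^sub>R D) \<le> \<epsilon> * \<bar>y - x\<bar>"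
      unfolding has_vector_derivative_def has_derivative_within_alt by (auto simp: abs_minus_commute)
    have "norm (f v - f u) \<le> (B + \<epsilon>) * (v - u)"
      if uv: "a \<le> u" "u \<le> x" "x \<le> v" "v \<le> b" "{u..v} \<subseteq> ball x d" for u v
    proof -
      have "u \<in> {u..v}" "v \<in> {u..v}" using uv by auto
      then have "u \<in> ball x d" "v \<in> ball x d" using uv(5) by blast+
      then have *: "norm (f v - f x - (v - x) *\<^sub>R D) \<le> \<epsilon> * \<bar>v - x\<bar>"
          "norm (f u - f x - (u - x) *\<^sub>R D) \<le> \<epsilon> * \<bar>u - x\<bar>"
        using d[of u] d[of v] uv by (auto simp: dist_real_def abs_minus_commute)
      have "f v - f u = (f v - f x - (v - x) *\<^sub>R D) - (f u - f x - (u - x) *\<^sub>R D) + (v - u) *\<^sub>R D"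
        by (simp add: algebra_simps)
      then have "norm (f v - f u) \<le> \<epsilon> * \<bar>v - x\<bar> + \<epsilon> * \<bar>u - x\<bar> + norm ((v - u) *\<^sub>R D)"
        using * by (smt (verit) norm_triangle_ineq norm_triangle_ineq4)
      also have "norm ((v - u) *\<^sub>R D) \<le> (v - u) * B"
        using uv D(2) by (simp add: mult_left_mono)
      finally show ?thesis using uv by (simp add: algebra_simps)
    qed
    with True \<open>0 < d\<close> show ?thesis by blast
  next
    case False
    with G show ?thesis by (cases "x \<in> N") (auto simp: open_contains_ball intro: zero_less_one)
  qed
  then obtain d where dpos: "\<And>x. 0 < d x" and dN: "\<And>x. x \<in> N \<Longrightarrow> ball x (d x) \<subseteq> G"
    and dgood: "\<And>x u v. x \<in> {a..b} - N \<Longrightarrow> a \<le> u \<Longrightarrow> u \<le> x \<Longrightarrow> x \<le> v \<Longrightarrow> v \<le> b \<Longrightarrow>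
        {u..v} \<subseteq> ball x (d x) \<Longrightarrow> norm (f v - f u) \<le> (B + \<epsilon>) * (v - u)"
    by metis
  have "gauge (\<lambda>x. ball x (d x))" using dpos by (simp add: gauge_def)
  then obtain p where p: "p tagged_division_of {a..b}" and fine: "(\<lambda>x. ball x (d x)) fine p"
    by (rule fine_division_exists_real)
  note pD = tagged_division_ofD[OF p]
  have int: "\<exists>c d. K = {c..d} \<and> a \<le> c \<and> c \<le> x \<and> x \<le> d \<and> d \<le> b" if "(x, K) \<in> p" for x K
    using pD(2)[OF that] pD(3)[OF that] pD(4)[OF that] by fastforce
  define p1 p2 where "p1 = {z\<in>p. fst z \<notin> N}" and "p2 = {z\<in>p. fst z \<in> N}"
  have p2: "p2 tagged_partial_division_of {a..b}"
    using p unfolding p2_def by (auto simp: tagged_division_of_def intro: tagged_partial_division_subset[of p])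
  have split: "sum g p = sum g p1 + sum g p2" for g :: "real \<times> real set \<Rightarrow> real"
    unfolding p1_def p2_def using pD(1)
    by (subst sum.union_disjoint[symmetric]) (auto intro!: sum.cong)
  have "f b - f a = (\<Sum>(x,K)\<in>p. f (Sup K) - f (Inf K))"
    by (rule additive_tagged_division_1[OF ab p, symmetric])
  then have "norm (f b - f a) \<le> (\<Sum>(x,K)\<in>p. norm (f (Sup K) - f (Inf K)))"
    by (simp add: sum_norm_le case_prod_beta)
  also have "\<dots> = (\<Sum>(x,K)\<in>p1. norm (f (Sup K) - f (Inf K))) + (\<Sum>(x,K)\<in>p2. norm (f (Sup K) - f (Inf K)))"
    by (rule split)
  also have "(\<Sum>(x,K)\<in>p1. norm (f (Sup K) - f (Inf K))) \<le> (\<Sum>(x,K)\<in>p1. (B + \<epsilon>) * (Sup K - Inf K))"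
  proof (rule sum_mono, clarify)
    fix x K assume xK: "(x, K) \<in> p1"
    then have "(x, K) \<in> p" "x \<notin> N" by (auto simp: p1_def)
    moreover have "K \<subseteq> ball x (d x)" using fine \<open>(x, K) \<in> p\<close> by (auto simp: fine_def)
    ultimately show "norm (f (Sup K) - f (Inf K)) \<le> (B + \<epsilon>) * (Sup K - Inf K)"
      using int[of x K] by (auto intro!: dgood[of x])
  qed
  also have "\<dots> \<le> (\<Sum>(x,K)\<in>p. (B + \<epsilon>) * (Sup K - Inf K))"
    using pD(1) \<open>0 \<le> B\<close> \<epsilon>(1)
    by (intro sum_mono2) (auto simp: p1_def dest!: int)
  also have "\<dots> = (B + \<epsilon>) * (b - a)"
    using additive_tagged_division_1[OF ab p, of "\<lambda>x. x"]
    by (simp add: sum_distrib_left[symmetric] case_prod_beta)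
  also have "(\<Sum>(x,K)\<in>p2. norm (f (Sup K) - f (Inf K))) \<le> \<epsilon>"
  proof -
    have "K \<subseteq> G" if "(x, K) \<in> p2" for x K
      using that fine dN[of x] by (force simp: p2_def fine_def)
    then have "(\<Sum>(x,K)\<in>p2. Sup K - Inf K) < \<delta>"
      using sum_lengths_le_measure[OF p2 _ Gm(1)] Gm(2) by fastforce
    from sum_dist_less_of_absolutely_continuous[of a b \<delta> f \<epsilon>, OF \<delta> p2 this]
    show ?thesis by (simp add: dist_norm norm_minus_commute)
  qed
  finally show "norm (f b - f a) \<le> B * (b - a) + e"
    using \<epsilon>(2) by (simp add: algebra_simps)
qed

text \<open>The mean value bound for \<open>f t - t D\<close>: it is this form that compares a solution with one Euler step.\<close>

lemma absolutely_continuous_affine_approximation: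
  fixes f :: "real \<Rightarrow> 'a::real_normed_vector"
  assumes ab: "a \<le> b" and ac: "absolutely_continuous_on a b f" and "0 \<le> B"
    and der: "AE t in lebesgue. t \<in> {a..b} \<longrightarrow>
      (\<exists>D'. (f has_vector_derivative D') (at t within {a..b}) \<and> norm (D' - D) \<le> B)"
  shows "norm (f b - f a - (b - a) *\<^sub>R D) \<le> B * (b - a)"
proof -
  have "absolutely_continuous_on a b (\<lambda>t. t *\<^sub>R D)"
    by (rule absolutely_continuous_on_lipschitz[of _ _ _ "norm D"])
      (simp add: dist_norm scaleR_diff_left[symmetric] mult.commute)
  then have "absolutely_continuous_on a b (\<lambda>t. f t - t *\<^sub>R D)"
    using ac by (rule absolutely_continuous_on_diff[rotated])
  then have "norm ((f b - b *\<^sub>R D) - (f a - a *\<^sub>R D)) \<le> B * (b - a)"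
  proof (rule absolutely_continuous_mean_value_bound[OF ab _ \<open>0 \<le> B\<close>])
    show "AE t in lebesgue. t \<in> {a..b} \<longrightarrow>
      (\<exists>D'. ((\<lambda>t. f t - t *\<^sub>R D) has_vector_derivative D') (at t within {a..b}) \<and> norm D' \<le> B)"
      using der
    proof eventually_elim
      case (elim t)
      show ?case
      proof
        assume "t \<in> {a..b}"
        with elim obtain D' where D': "(f has_vector_derivative D') (at t within {a..b})" "norm (D' - D) \<le> B"
          by blast
        have "((\<lambda>t. f t - t *\<^sub>R D) has_vector_derivative (D' - D)) (at t within {a..b})"
          using D'(1) by (auto intro!: derivative_eq_intros)
        with D'(2) show "\<exists>D'. ((\<lambda>t. f t - t *\<^sub>R D) has_vector_derivative D') (at t within {a..b}) \<and> norm D' \<le> B"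
          by blast
      qed
    qed
  qed
  then show ?thesis by (simp add: algebra_simps)
qed

section \<open>Oscillation sums of Riemann integrable functions\<close>

text \<open>The oscillation sum is the Lebesgue integral of the step function whose value on each partial interval
  is the oscillation of \<open>f\<close> there. At a point of continuity these step functions tend to \<open>0\<close>, and they
  are bounded, so dominated convergence applies.\<close>

theorem riemann_oscillation_sum_tendsto_0:
  fixes f :: "real \<Rightarrow> 'a::real_normed_vector" and a b :: real
  defines "x \<equiv> \<lambda>N n. a + real n * ((b - a) / real N)"
  assumes ab: "a < b" and bdd: "bounded (f ` {a..b})" and cont: "AE t in lebesgue. isCont f t"
  shows "(\<lambda>N. (b - a) / real N * (\<Sum>n<N. diameter (f ` {x N n..x N (Suc n)}))) \<longlonglongrightarrow> 0"
proof -
  define D where "D N n = diameter (f ` {x N n..x N (Suc n)})" for N n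
  define J where "J N n = {x N n..<x N (Suc n)}" for N n
  define s where "s N t = (\<Sum>n<N. D N n * indicator (J N n) t)" for N t
  have step: "x N (Suc n) - x N n = (b - a) / real N" for N n
    by (simp add: x_def algebra_simps add_divide_distrib[symmetric] diff_divide_distrib[symmetric])
  have x_mono: "x N m \<le> x N n" if "m \<le> n" for N m n
    using that ab by (auto simp: x_def intro!: divide_right_mono mult_right_mono)
  have x_range: "a \<le> x N n" "x N n \<le> b" if "n \<le> N" "0 < N" for N n
  proof -
    show "a \<le> x N n" using x_mono[of 0 n N] by (simp add: x_def)
    have "x N N = b" using that by (simp add: x_def)
    then show "x N n \<le> b" using x_mono[of n N N] that by simp
  qed
  have bdd_I: "bounded (f ` {x N n..x N (Suc n)})" if "n < N" for N n
    using that x_range[of n N] x_range[of "Suc n" N]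
    by (intro bounded_subset[OF bdd] image_mono) auto
  have D_nonneg: "0 \<le> D N n" if "n < N" for N n
    unfolding D_def by (rule diameter_ge_0[OF bdd_I[OF that]])
  have D_le: "D N n \<le> diameter (f ` {a..b})" if "n < N" for N n
    unfolding D_def using that x_range[of n N] x_range[of "Suc n" N]
    by (intro diameter_subset bdd image_mono) auto
  \<comment> \<open>The half-open intervals are disjoint, so at most one summand of the step function is nonzero.\<close>
  have cases: "(\<forall>n<N. t \<notin> J N n) \<and> s N t = 0 \<or> (\<exists>n<N. t \<in> J N n \<and> s N t = D N n)" for N t
  proof (cases "\<exists>n<N. t \<in> J N n")
    case True
    then obtain n where n: "n < N" "t \<in> J N n" by auto
    have "t \<notin> J N m" if "m \<noteq> n" for m
      using n(2) that x_mono[of "Suc m" n N] x_mono[of "Suc n" m N]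
      by (cases "m < n") (auto simp: J_def)
    then have "s N t = (\<Sum>m<N. if m = n then D N n else 0)"
      unfolding s_def using n(2) by (intro sum.cong) (auto simp: indicator_def)
    with n show ?thesis by auto
  qed (auto simp: s_def)
  have int_J: "integrable lebesgue (indicator (J N n) :: real \<Rightarrow> real)" for N n
    unfolding J_def using x_mono[of n "Suc n" N] by (intro integrable_real_indicator) auto
  have int_s: "integral\<^sup>L lebesgue (s N) = (b - a) / real N * (\<Sum>n<N. D N n)" for N
  proof -
    have "integral\<^sup>L lebesgue (s N) = (\<Sum>n<N. D N n * measure lebesgue (J N n))"
      unfolding s_def by (subst Bochner_Integration.integral_sum) (auto simp: int_J)
    also have "\<dots> = (\<Sum>n<N. D N n * ((b - a) / real N))"
      by (rule sum.cong) (use step x_mono in \<open>auto simp: J_def\<close>)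
    finally show ?thesis by (simp add: sum_distrib_left sum_divide_distrib mult.commute)
  qed
  have "(\<lambda>N. integral\<^sup>L lebesgue (s N)) \<longlonglongrightarrow> integral\<^sup>L lebesgue (\<lambda>t::real. 0 :: real)"
  proof (rule integral_dominated_convergence[where w = "\<lambda>t. diameter (f ` {a..b}) * indicator {a..b} t"])
    show "s N \<in> borel_measurable lebesgue" for N
      unfolding s_def by (intro borel_measurable_sum borel_measurable_times borel_measurable_const
          borel_measurable_integrable[OF int_J])
    show "AE t in lebesgue. norm (s N t) \<le> diameter (f ` {a..b}) * indicator {a..b} t" for N
    proof (rule AE_I2)
      fix t
      from cases[of N t] show "norm (s N t) \<le> diameter (f ` {a..b}) * indicator {a..b} t"
      proof (elim disjE exE conjE)
        fix n assume n: "n < N" "t \<in> J N n" "s N t = D N n"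
        with x_range[of n N] x_range[of "Suc n" N] have "t \<in> {a..b}" by (auto simp: J_def)
        with n D_le D_nonneg show ?thesis by simp
      qed (use diameter_ge_0[OF bdd] in simp)
    qed
    show "AE t in lebesgue. (\<lambda>N. s N t) \<longlonglongrightarrow> 0"
      using cont
    proof eventually_elim
      fix t assume t: "isCont f t"
      show "(\<lambda>N. s N t) \<longlonglongrightarrow> 0"
      proof (rule LIMSEQ_I)
        fix e :: real assume "0 < e"
        then obtain d where "0 < d" and d: "\<And>y. dist y t < d \<Longrightarrow> dist (f y) (f t) < e / 4"
          using t unfolding continuous_at_eps_delta by (metis zero_less_divide_iff zero_less_numeral)
        obtain M where M: "(b - a) / d < real M" using reals_Archimedean2 by blast
        have "norm (s N t - 0) < e" if "M \<le> N" for N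
          using cases[of N t]
        proof (elim disjE exE conjE)
          fix n assume n: "n < N" "t \<in> J N n" "s N t = D N n"
          have "(b - a) / d < real N" using M that by linarith
          then have h: "(b - a) / real N < d" using \<open>0 < d\<close> n(1) by (simp add: field_simps)
          have near: "dist (f y) (f t) < e / 4" if "y \<in> {x N n..x N (Suc n)}" for y
            using n(2) that step[of N n] h by (intro d) (auto simp: J_def dist_real_def abs_less_iff)
          have "D N n \<le> e / 2"
            unfolding D_def
          proof (rule diameter_le)
            fix u v assume "u \<in> f ` {x N n..x N (Suc n)}" "v \<in> f ` {x N n..x N (Suc n)}"
            then have "dist u (f t) < e / 4" "dist v (f t) < e / 4" using near by auto
            then have "dist u v \<le> e / 2" using dist_triangle2[of u v "f t"] by linarith
            then show "norm (u - v) \<le> e / 2" by (simp add: dist_norm)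
          qed (use \<open>0 < e\<close> in auto)
          with n D_nonneg[of n N] \<open>0 < e\<close> show ?thesis by simp
        qed (use \<open>0 < e\<close> in simp)
        then show "\<exists>M. \<forall>N\<ge>M. norm (s N t - 0) < e" by blast
      qed
    qed
  next
    have "integrable lebesgue (indicator {a..b} :: real \<Rightarrow> real)"
      by (intro integrable_real_indicator) (use ab in auto)
    then show "integrable lebesgue (\<lambda>t. diameter (f ` {a..b}) * indicator {a..b} t :: real)"
      by (rule integrable_mult_right)
  qed simp
  then show ?thesis by (simp add: int_s D_def)
qed

section \<open>Solutions in the sense of Caratheodory\<close>

lemma integrable_of_ae_continuous_bounded:
  fixes f :: "real \<Rightarrow> 'b::euclidean_space"
  assumes cont: "AE t in lebesgue. isCont f t" and bdd: "\<And>t. t \<in> {a..b} \<Longrightarrow> norm (f t) \<le> B"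
  shows "f integrable_on {a..b}"
proof -
  obtain N where N: "N \<in> null_sets lebesgue" "{t \<in> space lebesgue. \<not> isCont f t} \<subseteq> N"
    using cont unfolding eventually_ae_filter by blast
  have "continuous_on (- N) f"
    using N(2) by (intro continuous_at_imp_continuous_on) auto
  then have "f \<in> borel_measurable (lebesgue_on (- N))"
    using N(1) by (intro continuous_imp_measurable_on_sets_lebesgue) (auto intro: Compl_in_sets_lebesgue[THEN iffD2])
  then have "f \<in> borel_measurable lebesgue"
    using lebesgue_measurable_diff_null[OF N(1)] by blast
  then have "f \<in> borel_measurable (lebesgue_on {a..b})"
    by (simp add: measurable_restrict_space1)
  then show ?thesis
    by (rule measurable_bounded_by_integrable_imp_integrable[where g = "\<lambda>_. B"]) (use bdd in auto)
qed

text \<open>Continuity of \<open>F\<close> in the time variable alone is enough, because the Lipschitz bound is uniform in time.\<close>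

lemma isCont_lipschitz_family_comp:
  fixes F :: "real \<Rightarrow> 'a::real_normed_vector \<Rightarrow> 'b::real_normed_vector"
  assumes lip: "\<And>t x y. norm (F t x - F t y) \<le> K * norm (x - y)"
    and F: "\<And>x. isCont (\<lambda>s. F s x) t" and u: "isCont u t"
  shows "isCont (\<lambda>s. F s (u s)) t"
proof -
  have "((\<lambda>s. F s (u s) - F s (u t)) \<longlongrightarrow> 0) (at t)"
  proof (rule Lim_null_comparison)
    show "\<forall>\<^sub>F s in at t. norm (F s (u s) - F s (u t)) \<le> K * norm (u s - u t)"
      using lip by simp
    have "((\<lambda>s. K * norm (u s - u t)) \<longlongrightarrow> K * norm (u t - u t)) (at t)"
      using u unfolding isCont_def by (intro tendsto_intros)
    then show "((\<lambda>s. K * norm (u s - u t)) \<longlongrightarrow> 0) (at t)" by simp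
  qed
  moreover have "((\<lambda>s. F s (u t)) \<longlongrightarrow> F t (u t)) (at t)"
    using F unfolding isCont_def .
  ultimately have "((\<lambda>s. (F s (u s) - F s (u t)) + F s (u t)) \<longlongrightarrow> 0 + F t (u t)) (at t)"
    by (rule tendsto_add)
  then show ?thesis by (simp add: isCont_def)
qed

text \<open>Picard's theorem on the whole interval at once. In the unknown \<open>y t = exp (- L (t - a)) v t\<close> with \<open>L = 2 K\<close>
  the Picard operator contracts by \<open>K / L = 1/2\<close> whatever the length of the interval. The fixed point is
  sought among bounded continuous functions on the whole line, so the operator is extended constantly
  outside \<open>{a..b}\<close> by means of the projection \<open>\<tau>\<close>.\<close>

theorem caratheodory_integral_equation_solvable:
  fixes F :: "real \<Rightarrow> 'a::euclidean_space \<Rightarrow> 'a"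
  assumes ab: "a \<le> b" and K: "0 < K"
    and lip: "\<And>t x y. norm (F t x - F t y) \<le> K * norm (x - y)"
    and bdd: "\<And>t. norm (F t 0) \<le> B"
    and cont: "AE t in lebesgue. \<forall>x. isCont (\<lambda>s. F s x) t"
  obtains v where "continuous_on UNIV v" "bounded (v ` {a..b})"
    "\<And>c. (\<lambda>s. F s (v s)) integrable_on {a..c}"
    "\<And>t. t \<in> {a..b} \<Longrightarrow> v t = x0 + integral {a..t} (\<lambda>s. F s (v s))"
proof -
  define L where "L = 2 * K"
  have L: "0 < L" using K by (simp add: L_def)
  define w where "w y s = exp (L * (s - a)) *\<^sub>R apply_bcontfun y s" for y :: "real \<Rightarrow>\<^sub>C 'a" and s
  define \<phi> where "\<phi> y t = exp (- L * (t - a)) *\<^sub>R (x0 + integral {a..t} (\<lambda>s. F s (w y s)))"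
    for y :: "real \<Rightarrow>\<^sub>C 'a" and t
  define \<tau> where "\<tau> t = max a (min b t)" for t
  have \<tau>: "\<tau> t \<in> {a..b}" for t using ab by (auto simp: \<tau>_def)
  have cont_w: "continuous_on UNIV (w y)" for y
    unfolding w_def by (intro continuous_intros continuous_on_apply_bcontfun)
  have bdd_w: "bounded (w y ` {c..d})" for y c d
    using continuous_on_subset[OF cont_w[of y], of "{c..d}"]
    by (intro compact_imp_bounded compact_continuous_image) auto
  have int: "(\<lambda>s. F s (w y s)) integrable_on {a..c}" for y c
  proof -
    obtain W where W: "\<And>s. s \<in> {a..c} \<Longrightarrow> norm (w y s) \<le> W"
      using bdd_w[of y a c] unfolding bounded_iff by blast
    show ?thesis
    proof (rule integrable_of_ae_continuous_bounded)
      show "AE t in lebesgue. isCont (\<lambda>s. F s (w y s)) t"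
        using cont
      proof eventually_elim
        case (elim t)
        have "isCont (w y) t" using cont_w by (simp add: continuous_on_eq_continuous_at)
        from isCont_lipschitz_family_comp[OF lip elim[rule_format] this] show ?case .
      qed
      show "norm (F t (w y t)) \<le> B + K * W" if "t \<in> {a..c}" for t
      proof -
        have "norm (F t (w y t)) \<le> norm (F t 0) + norm (F t (w y t) - F t 0)"
          using norm_triangle_sub[of "F t (w y t)" "F t 0"] by simp
        also have "\<dots> \<le> B + K * norm (w y t)" using bdd[of t] lip[of t "w y t" 0] by simp
        also have "\<dots> \<le> B + K * W" using W[OF that] K by simp
        finally show ?thesis .
      qed
    qed
  qed
  have cont_\<phi>: "continuous_on {a..b} (\<phi> y)" for y
    unfolding \<phi>_def by (intro continuous_intros indefinite_integral_continuous_1 int)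
  have bcf: "(\<lambda>t. \<phi> y (\<tau> t)) \<in> bcontfun" for y
  proof -
    have "continuous_on UNIV (\<lambda>t. \<phi> y (\<tau> t))"
      by (rule continuous_on_compose2[OF cont_\<phi>]) (use \<tau> in \<open>auto simp: \<tau>_def intro!: continuous_intros\<close>)
    moreover have "bounded (range (\<lambda>t. \<phi> y (\<tau> t)))"
    proof (rule bounded_subset)
      show "bounded (\<phi> y ` {a..b})"
        using cont_\<phi> by (intro compact_imp_bounded compact_continuous_image) auto
    qed (use \<tau> in auto)
    ultimately show ?thesis by (simp add: bcontfun_def)
  qed
  define P where "P y = Bcontfun (\<lambda>t. \<phi> y (\<tau> t))" for y
  have P: "apply_bcontfun (P y) t = \<phi> y (\<tau> t)" for y t
    unfolding P_def by (simp add: Bcontfun_inverse bcf)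
  have "\<exists>!y. P y = y"
  proof (rule banach_fix_type[where c = "1/2"]; (intro allI)?)
    fix y z
    show "dist (P y) (P z) \<le> 1/2 * dist y z"
    proof (rule dist_bound)
      fix t
      define T where "T = \<tau> t"
      have T: "a \<le> T" using \<tau>[of t] by (simp add: T_def)
      have exp_int: "((\<lambda>s. K * dist y z * exp (L * (s - a))) has_integral
          K * dist y z * exp (L * (T - a)) / L - K * dist y z * exp (L * (a - a)) / L) {a..T}"
        by (rule fundamental_theorem_of_calculus[OF T])
          (use L in \<open>auto intro!: derivative_eq_intros simp: has_real_derivative_iff_has_vector_derivative[symmetric]\<close>)
      have "dist (P y t) (P z t) =
          exp (- L * (T - a)) * norm (integral {a..T} (\<lambda>s. F s (w y s) - F s (w z s)))"
        by (simp add: P \<phi>_def T_def[symmetric] dist_norm scaleR_diff_right[symmetric]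
            integral_diff[OF int int])
      also have "norm (integral {a..T} (\<lambda>s. F s (w y s) - F s (w z s)))
          \<le> integral {a..T} (\<lambda>s. K * dist y z * exp (L * (s - a)))"
      proof (rule integral_norm_bound_integral)
        fix s
        have "norm (F s (w y s) - F s (w z s)) \<le> K * norm (w y s - w z s)" by (rule lip)
        also have "\<dots> = K * (exp (L * (s - a)) * dist (y s) (z s))"
          by (simp add: w_def scaleR_diff_right[symmetric] dist_norm)
        also have "\<dots> \<le> K * (exp (L * (s - a)) * dist y z)"
          using K by (intro mult_left_mono dist_bounded) auto
        finally show "norm (F s (w y s) - F s (w z s)) \<le> K * dist y z * exp (L * (s - a))"
          by (simp add: algebra_simps)
      qed (use exp_int int in \<open>auto intro: integrable_diff\<close>)
      also have "\<dots> = K * dist y z * exp (L * (T - a)) / L - K * dist y z / L"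
        using integral_unique[OF exp_int] by simp
      also have "\<dots> \<le> K * dist y z * exp (L * (T - a)) / L"
        using K L by simp
      finally have "dist (P y t) (P z t) \<le>
          exp (- L * (T - a)) * (K * dist y z * exp (L * (T - a)) / L)"
        by (simp add: mult_left_mono)
      also have "\<dots> = (exp (- L * (T - a)) * exp (L * (T - a))) * (K / L * dist y z)"
        by (simp add: field_simps)
      also have "\<dots> = 1/2 * dist y z"
        unfolding exp_add[symmetric] using K by (simp add: L_def)
      finally show "dist (P y t) (P z t) \<le> 1/2 * dist y z" .
    qed
  qed auto
  then obtain y where y: "P y = y" by blast
  show thesis
  proof (rule that[of "w y"])
    show "bounded (w y ` {a..b})" by (rule bdd_w)
    show "w y t = x0 + integral {a..t} (\<lambda>s. F s (w y s))" if "t \<in> {a..b}" for t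
    proof -
      have "w y t = exp (L * (t - a)) *\<^sub>R \<phi> y (\<tau> t)"
        using P[of y t] by (simp add: y w_def)
      also have "\<tau> t = t" using that by (simp add: \<tau>_def)
      finally show ?thesis by (simp add: \<phi>_def exp_add[symmetric])
    qed
  qed (use cont_w int in auto)
qed

text \<open>The integral of a bounded function is Lipschitz, hence absolutely continuous, and it is
  differentiable wherever the integrand is continuous.\<close>

theorem caratheodory_solution_exists:
  fixes F :: "real \<Rightarrow> 'a::euclidean_space \<Rightarrow> 'a"
  assumes ab: "a \<le> b" and K: "0 < K"
    and lip: "\<And>t x y. norm (F t x - F t y) \<le> K * norm (x - y)"
    and bdd: "\<And>t. norm (F t 0) \<le> B"
    and cont: "AE t in lebesgue. \<forall>x. isCont (\<lambda>s. F s x) t"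
  obtains v where "v a = x0" "absolutely_continuous_on a b v"
    "AE t in lebesgue. t \<in> {a..b} \<longrightarrow> (v has_vector_derivative F t (v t)) (at t within {a..b})"
proof -
  obtain v where cont_v: "continuous_on UNIV v" and bdd_v: "bounded (v ` {a..b})"
    and int: "\<And>c. (\<lambda>s. F s (v s)) integrable_on {a..c}"
    and v: "\<And>t. t \<in> {a..b} \<Longrightarrow> v t = x0 + integral {a..t} (\<lambda>s. F s (v s))"
    using caratheodory_integral_equation_solvable[OF assms] by blast
  obtain W where W: "\<And>s. s \<in> {a..b} \<Longrightarrow> norm (v s) \<le> W"
    using bdd_v unfolding bounded_iff by blast
  have bound: "norm (F t (v t)) \<le> B + K * W" if "t \<in> {a..b}" for t
  proof -
    have "norm (F t (v t)) \<le> norm (F t 0) + norm (F t (v t) - F t 0)"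
      using norm_triangle_sub[of "F t (v t)" "F t 0"] by simp
    also have "\<dots> \<le> B + K * norm (v t)" using bdd[of t] lip[of t "v t" 0] by simp
    also have "\<dots> \<le> B + K * W" using W[OF that] K by simp
    finally show ?thesis .
  qed
  show thesis
  proof (rule that)
    show "v a = x0" using v[of a] ab by simp
    show "absolutely_continuous_on a b v"
    proof (rule absolutely_continuous_on_lipschitz)
      fix x y assume xy: "a \<le> x" "x \<le> y" "y \<le> b"
      have "v y - v x = integral {x..y} (\<lambda>s. F s (v s))"
        using v[of x] v[of y] xy Henstock_Kurzweil_Integration.integral_combine[of a x y "\<lambda>s. F s (v s)"] int
        by (simp add: algebra_simps)
      also have "norm \<dots> \<le> (B + K * W) * (y - x)"
        using integral_norm_bound_integral[of "\<lambda>s. F s (v s)" "{x..y}" "\<lambda>_. B + K * W"]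
          bound xy integrable_on_subinterval[OF int[of y], of x y]
          integrable_const_ivl[of "B + K * W" x y]
        by (simp add: mult.commute)
      finally show "dist (v x) (v y) \<le> (B + K * W) * (y - x)"
        by (simp add: dist_norm norm_minus_commute)
    qed
    show "AE t in lebesgue. t \<in> {a..b} \<longrightarrow> (v has_vector_derivative F t (v t)) (at t within {a..b})"
      using cont
    proof eventually_elim
      case (elim t)
      show ?case
      proof
        assume t: "t \<in> {a..b}"
        have "isCont v t" using cont_v by (simp add: continuous_on_eq_continuous_at)
        from isCont_lipschitz_family_comp[OF lip elim[rule_format] this]
        have "isCont (\<lambda>s. F s (v s)) t" .
        then have "((\<lambda>u. integral {a..u} (\<lambda>s. F s (v s))) has_vector_derivative F t (v t)) (at t within {a..b})"
          using integral_has_vector_derivative_continuous_at[of "\<lambda>s. F s (v s)" a b t "{}"] int t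
          by (simp add: continuous_at_imp_continuous_at_within)
        then have "((\<lambda>u. x0 + integral {a..u} (\<lambda>s. F s (v s))) has_vector_derivative F t (v t)) (at t within {a..b})"
          by (auto intro!: derivative_eq_intros)
        then show "(v has_vector_derivative F t (v t)) (at t within {a..b})"
          by (rule has_vector_derivative_transform[OF t, rotated]) (use v in auto)
      qed
    qed
  qed
qed

section \<open>The Frobenius norm and Neumann inverses\<close>

text \<open>The norm of a matrix, as a vector of vectors, is the Frobenius norm; both this inequality and its
  version for products of matrices are the Cauchy-Schwarz inequality.\<close>

lemma norm_matrix_vector_mult_le:
  fixes A :: "'a::real_normed_field^'n^'m"
  shows "norm (A *v x) \<le> norm A * norm x"
proof -
  have "norm ((A *v x) $ i) \<le> norm (A $ i) * norm x" for i
  proof -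
    have "norm ((A *v x) $ i) \<le> (\<Sum>j\<in>UNIV. \<bar>norm (A $ i $ j)\<bar> * \<bar>norm (x $ j)\<bar>)"
      by (simp add: matrix_vector_mult_def) (rule order_trans[OF norm_sum], simp add: norm_mult)
    also have "\<dots> \<le> norm (A $ i) * norm x"
      unfolding norm_vec_def by (rule L2_set_mult_ineq)
    finally show ?thesis .
  qed
  then have "norm (A *v x) \<le> L2_set (\<lambda>i. norm (A $ i) * norm x) UNIV"
    unfolding norm_vec_def[of "A *v x"] by (intro L2_set_mono) auto
  also have "\<dots> = norm A * norm x"
    by (simp add: norm_vec_def[of A] L2_set_left_distrib)
  finally show ?thesis .
qed

lemma norm_matrix_mult_le:
  fixes A :: "'a::real_normed_field^'n^'m" and B :: "'a^'p^'n"
  shows "norm (A ** B) \<le> norm A * norm B"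
proof -
  have "norm ((A ** B) $ i) \<le> norm (A $ i) * norm B" for i
  proof -
    have "(A ** B) $ i = (\<Sum>j\<in>UNIV. A $ i $ j *s B $ j)"
      by (simp add: matrix_matrix_mult_def vec_eq_iff)
    then have "norm ((A ** B) $ i) \<le> (\<Sum>j\<in>UNIV. norm (A $ i $ j *s B $ j))"
      by (simp add: norm_sum)
    also have "\<dots> = (\<Sum>j\<in>UNIV. \<bar>norm (A $ i $ j)\<bar> * \<bar>norm (B $ j)\<bar>)"
      by (simp add: norm_vec_def norm_mult L2_set_right_distrib)
    also have "\<dots> \<le> norm (A $ i) * norm B"
      unfolding norm_vec_def[of "A $ i"] norm_vec_def[of B] by (rule L2_set_mult_ineq)
    finally show ?thesis .
  qed
  then have "norm (A ** B) \<le> L2_set (\<lambda>i. norm (A $ i) * norm B) UNIV"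
    unfolding norm_vec_def[of "A ** B"] by (intro L2_set_mono) auto
  also have "\<dots> = norm A * norm B"
    by (simp add: norm_vec_def[of A] L2_set_left_distrib)
  finally show ?thesis .
qed

lemma bounded_bilinear_matrix_mult:
  "bounded_bilinear ((**) :: 'a::real_normed_field^'n^'m \<Rightarrow> 'a^'p^'n \<Rightarrow> _)"
proof
  show "\<exists>K. \<forall>(A :: 'a^'n^'m) (B :: 'a^'p^'n). norm (A ** B) \<le> norm A * norm B * K"
    using norm_matrix_mult_le by (metis mult.right_neutral)
qed (simp_all add: matrix_matrix_mult_def vec_eq_iff algebra_simps sum.distrib scaleR_sum_right)

lemma bounded_bilinear_matrix_vector_mult:
  "bounded_bilinear ((*v) :: 'a::real_normed_field^'n^'m \<Rightarrow> 'a^'n \<Rightarrow> _)"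
proof
  show "\<exists>K. \<forall>(A :: 'a^'n^'m) x. norm (A *v x) \<le> norm A * norm x * K"
    using norm_matrix_vector_mult_le by (metis mult.right_neutral)
qed (simp_all add: matrix_vector_mult_def vec_eq_iff algebra_simps sum.distrib scaleR_sum_right)

lemmas matrix_mult_diff_left = bounded_bilinear.diff_left[OF bounded_bilinear_matrix_mult]
  and matrix_mult_diff_right = bounded_bilinear.diff_right[OF bounded_bilinear_matrix_mult]
  and matrix_mult_add_left = bounded_bilinear.add_left[OF bounded_bilinear_matrix_mult]
  and matrix_mult_scaleR_left = bounded_bilinear.scaleR_left[OF bounded_bilinear_matrix_mult]
  and matrix_mult_scaleR_right = bounded_bilinear.scaleR_right[OF bounded_bilinear_matrix_mult]
  and matrix_vector_mult_scaleR_left = bounded_bilinear.scaleR_left[OF bounded_bilinear_matrix_vector_mult]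

lemma norm_matrix_le_of_entries:
  fixes M :: "'a::real_normed_vector^'n^'m"
  assumes "\<And>i j. norm (M $ i $ j) \<le> e"
  shows "norm M \<le> real CARD('m) * real CARD('n) * e"
proof -
  have "norm M \<le> (\<Sum>i\<in>UNIV. norm (M $ i))"
    unfolding norm_vec_def[of M] by (rule L2_set_le_sum) simp
  also have "\<dots> \<le> (\<Sum>i\<in>(UNIV::'m set). \<Sum>j\<in>(UNIV::'n set). norm (M $ i $ j))"
    by (rule sum_mono) (simp add: norm_vec_def[of "M $ _"] L2_set_le_sum)
  also have "\<dots> \<le> (\<Sum>i\<in>(UNIV::'m set). \<Sum>j\<in>(UNIV::'n set). e)"
    by (intro sum_mono assms)
  finally show ?thesis by (simp add: mult.assoc)
qed

lemma norm_matrix_entry_le: "norm (M $ i $ j) \<le> norm (M :: 'a::real_normed_vector^'n^'m)"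
  by (meson Finite_Cartesian_Product.norm_nth_le order_trans)

lemma invertible_mat_1_diff:
  fixes K :: "'a::real_normed_field^'n^'n"
  assumes "norm K < 1"
  shows "invertible (mat 1 - K)"
  unfolding invertible_left_inverse matrix_left_invertible_ker
proof (intro allI impI)
  fix x assume "(mat 1 - K) *v x = 0"
  then have "x = K *v x" by (simp add: matrix_vector_mult_diff_rdistrib)
  then have "norm x \<le> norm K * norm x" by (metis norm_matrix_vector_mult_le)
  then have "(1 - norm K) * norm x \<le> 0" by (simp add: algebra_simps)
  then show "x = 0" using assms by (simp add: mult_le_0_iff)
qed

text \<open>The inverse \<open>R\<close> satisfies \<open>R - 1 = K R\<close>, so \<open>norm R\<close> is at most twice the norm of the identity. The
  latter is in general not \<open>1\<close> for the Frobenius norm and has to be carried along.\<close>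

lemma norm_matrix_inv_mat_1_diff_le:
  fixes K :: "'a::real_normed_field^'n^'n"
  assumes K: "norm K \<le> 1/2"
  shows "norm (matrix_inv (mat 1 - K) - mat 1) \<le> 2 * norm (mat 1 :: 'a^'n^'n) * norm K"
proof -
  define R where "R = matrix_inv (mat 1 - K)"
  have "invertible (mat 1 - K)" using K by (intro invertible_mat_1_diff) simp
  then have "(mat 1 - K) ** R = mat 1"
    unfolding R_def matrix_inv_def invertible_def by (rule someI2_ex) simp
  then have R: "R - mat 1 = K ** R"
    by (simp add: matrix_mult_diff_left algebra_simps)
  have "norm R \<le> norm (mat 1 :: 'a^'n^'n) + norm (K ** R)"
    using norm_triangle_sub[of R "mat 1"] R by simp
  also have "norm (K ** R) \<le> 1/2 * norm R"
    using norm_matrix_mult_le[of K R] K by (meson mult_right_mono norm_ge_zero order_trans)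
  finally have "norm R \<le> 2 * norm (mat 1 :: 'a^'n^'n)" by simp
  then have "norm K * norm R \<le> norm K * (2 * norm (mat 1 :: 'a^'n^'n))"
    by (intro mult_left_mono) auto
  then show ?thesis
    using norm_matrix_mult_le[of K R] R by (simp add: R_def[symmetric] mult_ac)
qed

section \<open>Local and accumulated errors\<close>

text \<open>One Euler step with the constant matrix \<open>G\<close>. The derivative differs from \<open>G v(s)\<close> by
  \<open>(M - G) v + G (v - v(s))\<close>: the first term is controlled by \<open>\<omega>\<close>, the second because \<open>v\<close> is Lipschitz with
  constant \<open>m V\<close>, which is itself an instance of the mean value bound.\<close>

lemma caratheodory_linear_step:
  fixes M :: "real \<Rightarrow> complex^'n^'n" and v :: "real \<Rightarrow> complex^'n"
  assumes ac: "absolutely_continuous_on a b v"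
    and der: "AE t in lebesgue. t \<in> {a..b} \<longrightarrow> (v has_vector_derivative (M t *v v t)) (at t within {a..b})"
    and V: "\<And>t. t \<in> {a..b} \<Longrightarrow> norm (v t) \<le> V" and m: "\<And>t. norm (M t) \<le> m"
    and st: "a \<le> s" "s \<le> t" "t \<le> b"
    and \<omega>: "\<And>x. x \<in> {s..t} \<Longrightarrow> norm (M x - G) \<le> \<omega>"
  shows "norm (v t - (v s + (t - s) *\<^sub>R (G *v v s))) \<le> (\<omega> * V + norm G * (m * V * (t - s))) * (t - s)"
proof -
  have "0 \<le> V" using order_trans[OF norm_ge_zero V[of s]] st by auto
  have "0 \<le> m" using m[of s] norm_ge_zero[of "M s"] by linarith
  have "0 \<le> \<omega>" using order_trans[OF norm_ge_zero \<omega>[of s]] st by auto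
  have ac': "absolutely_continuous_on s x v" if "x \<le> t" for x
    using ac st that by (intro absolutely_continuous_on_subset[OF ac]) auto
  have der': "AE y in lebesgue. y \<in> {s..x} \<longrightarrow> (v has_vector_derivative (M y *v v y)) (at y within {s..x})"
    if "x \<le> t" for x
    using der by eventually_elim
      (use st that in \<open>auto intro: has_vector_derivative_within_subset\<close>)
  have lip: "norm (v x - v s) \<le> m * V * (t - s)" if x: "x \<in> {s..t}" for x
  proof -
    have xt: "x \<le> t" using x by simp
    have "norm (v x - v s - (x - s) *\<^sub>R 0) \<le> m * V * (x - s)"
    proof (rule absolutely_continuous_affine_approximation)
      show "AE y in lebesgue. y \<in> {s..x} \<longrightarrow>
          (\<exists>D'. (v has_vector_derivative D') (at y within {s..x}) \<and> norm (D' - 0) \<le> m * V)"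
        using der'[OF xt]
      proof (rule AE_mp, intro AE_I2 impI)
        fix y assume d: "y \<in> {s..x} \<longrightarrow> (v has_vector_derivative (M y *v v y)) (at y within {s..x})"
          and y: "y \<in> {s..x}"
        have "norm (M y) * norm (v y) \<le> m * V"
          using m[of y] V[of y] y x st \<open>0 \<le> m\<close> by (intro mult_mono) auto
        then have "norm (M y *v v y) \<le> m * V"
          using norm_matrix_vector_mult_le[of "M y" "v y"] by linarith
        with d y show "\<exists>D'. (v has_vector_derivative D') (at y within {s..x}) \<and> norm (D' - 0) \<le> m * V"
          by auto
      qed
    qed (use x ac' \<open>0 \<le> m\<close> \<open>0 \<le> V\<close> in auto)
    also have "m * V * (x - s) \<le> m * V * (t - s)"
      using x \<open>0 \<le> m\<close> \<open>0 \<le> V\<close> by (intro mult_left_mono) auto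
    finally show ?thesis by simp
  qed
  have "norm (v t - v s - (t - s) *\<^sub>R (G *v v s)) \<le> (\<omega> * V + norm G * (m * V * (t - s))) * (t - s)"
  proof (rule absolutely_continuous_affine_approximation)
    show "AE y in lebesgue. y \<in> {s..t} \<longrightarrow> (\<exists>D'. (v has_vector_derivative D') (at y within {s..t})
        \<and> norm (D' - G *v v s) \<le> \<omega> * V + norm G * (m * V * (t - s)))"
      using der'[OF order_refl]
    proof (rule AE_mp, intro AE_I2 impI)
      fix y assume d: "y \<in> {s..t} \<longrightarrow> (v has_vector_derivative (M y *v v y)) (at y within {s..t})"
        and y: "y \<in> {s..t}"
      have "norm (M y *v v y - G *v v s) \<le> \<omega> * V + norm G * (m * V * (t - s))"
      proof -
        have "M y *v v y - G *v v s = (M y - G) *v v y + G *v (v y - v s)"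
          by (simp add: matrix_vector_mult_diff_rdistrib matrix_vector_mult_diff_distrib)
        moreover have "norm ((M y - G) *v v y) \<le> \<omega> * V"
          using \<omega>[OF y] V[of y] y st \<open>0 \<le> \<omega>\<close>
          by (intro order_trans[OF norm_matrix_vector_mult_le] mult_mono) auto
        moreover have "norm (G *v (v y - v s)) \<le> norm G * (m * V * (t - s))"
          using lip[OF y] by (intro order_trans[OF norm_matrix_vector_mult_le] mult_left_mono) auto
        ultimately show ?thesis using norm_triangle_ineq[of "(M y - G) *v v y" "G *v (v y - v s)"] by simp
      qed
      with d y show "\<exists>D'. (v has_vector_derivative D') (at y within {s..t})
          \<and> norm (D' - G *v v s) \<le> \<omega> * V + norm G * (m * V * (t - s))" by blast
    qed
  qed (use st ac' \<open>0 \<le> \<omega>\<close> \<open>0 \<le> m\<close> \<open>0 \<le> V\<close> in auto)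
  then show ?thesis by (simp add: diff_diff_eq)
qed

lemma discrete_gronwall:
  fixes e d :: "nat \<Rightarrow> real"
  assumes "0 \<le> \<alpha>" and d: "\<And>n. n < N \<Longrightarrow> 0 \<le> d n" and e0: "e 0 = 0"
    and step: "\<And>n. n < N \<Longrightarrow> e (Suc n) \<le> (1 + \<alpha>) * e n + d n" and "n \<le> N"
  shows "e n \<le> exp (real N * \<alpha>) * (\<Sum>j<N. d j)"
proof -
  have "e n \<le> (1 + \<alpha>) ^ n * (\<Sum>j<n. d j)"
    using \<open>n \<le> N\<close>
  proof (induction n)
    case 0
    then show ?case by (simp add: e0)
  next
    case (Suc n)
    have "e (Suc n) \<le> (1 + \<alpha>) * e n + d n" using step Suc.prems by simp
    also have "(1 + \<alpha>) * e n \<le> (1 + \<alpha>) * ((1 + \<alpha>) ^ n * (\<Sum>j<n. d j))"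
      using Suc \<open>0 \<le> \<alpha>\<close> by (intro mult_left_mono) auto
    also have "d n \<le> (1 + \<alpha>) ^ Suc n * d n"
      using \<open>0 \<le> \<alpha>\<close> d[of n] Suc.prems one_le_power[of "1 + \<alpha>" "Suc n"]
      by (intro mult_le_cancel_right1[THEN iffD2]) auto
    finally show ?case by (simp add: algebra_simps)
  qed
  also have "\<dots> \<le> exp (real N * \<alpha>) * (\<Sum>j<N. d j)"
  proof (rule mult_mono)
    have "(1 + \<alpha>) ^ n \<le> exp \<alpha> ^ n"
      using \<open>0 \<le> \<alpha>\<close> by (intro power_mono exp_ge_add_one_self) auto
    also have "\<dots> = exp (real n * \<alpha>)" by (simp add: exp_of_nat_mult)
    also have "\<dots> \<le> exp (real N * \<alpha>)" using \<open>n \<le> N\<close> \<open>0 \<le> \<alpha>\<close> by (simp add: mult_right_mono)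
    finally show "(1 + \<alpha>) ^ n \<le> exp (real N * \<alpha>)" .
    show "(\<Sum>j<n. d j) \<le> (\<Sum>j<N. d j)"
      using \<open>n \<le> N\<close> d by (intro sum_mono2) auto
  qed (use d \<open>n \<le> N\<close> in \<open>auto intro!: sum_nonneg\<close>)
  finally show ?thesis .
qed

section \<open>The one-step matrix of the exponential Runge-Kutta scheme\<close>

lemma matrix_2_eqI:
  fixes M :: "'a::zero^2^2"
  assumes "M $ 1 $ 1 = a" "M $ 1 $ 2 = b" "M $ 2 $ 1 = c" "M $ 2 $ 2 = d"
  shows "M = vector [vector [a, b], vector [c, d]]"
  using assms by (simp add: vec_eq_iff forall_2)

lemma mat_mult_sigma3: "mat z ** sigma3 = vector [vector [z, 0], vector [0, - z]]"
  by (rule matrix_2_eqI) (simp_all add: matrix_matrix_mult_def sum_2 mat_def sigma3_def)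

lemma mexp_mat_mult_sigma3:
  "mexp (mat z ** sigma3) = vector [vector [exp z, 0], vector [0, exp (- z)]]"
proof -
  define T where "T n = (((**) (mat z ** sigma3)) ^^ n) (mat 1) /\<^sub>R fact n" for n
  define E where "E = (vector [vector [exp z, 0], vector [0, exp (- z)]] :: complex^2^2)"
  have pow: "(((**) (mat z ** sigma3)) ^^ n) (mat 1)
      = (vector [vector [z ^ n, 0], vector [0, (- z) ^ n]] :: complex^2^2)" for n
  proof (induction n)
    case 0
    then show ?case by (intro matrix_2_eqI) (simp_all add: mat_def)
  next
    case (Suc n)
    have "(((**) (mat z ** sigma3)) ^^ Suc n) (mat 1)
        = mat z ** sigma3 ** (vector [vector [z ^ n, 0], vector [0, (- z) ^ n]] :: complex^2^2)"
      using Suc by simp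
    also have "\<dots> = vector [vector [z ^ Suc n, 0], vector [0, (- z) ^ Suc n]]"
      unfolding mat_mult_sigma3
      by (rule matrix_2_eqI) (simp_all add: matrix_matrix_mult_def sum_2)
    finally show ?case .
  qed
  have "T sums E"
    unfolding sums_def
  proof (intro vec_tendstoI)
    fix i j
    have "(\<lambda>n. T n $ i $ j) sums (E $ i $ j)"
      using exhaust_2[of i] exhaust_2[of j] exp_converges[of z] exp_converges[of "- z"]
      by (auto simp: T_def E_def pow)
    then show "(\<lambda>n. (\<Sum>k<n. T k) $ i $ j) \<longlonglongrightarrow> E $ i $ j"
      by (simp add: sums_def)
  qed
  then show ?thesis
    unfolding mexp_def T_def E_def by (rule sums_unique[symmetric])
qed

lemma norm_exp_minus_1_le: "norm (exp z - 1) \<le> exp (norm z) * norm (z :: complex)"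
  using Taylor_exp_field[of z 0] by simp

lemma norm_exp_minus_1_minus_le: "norm (exp z - 1 - z) \<le> exp (norm z) * norm (z :: complex) ^ 2"
  using Taylor_exp_field[of z 1] by (simp add: algebra_simps power2_eq_square)

lemma norm_mexp_linearization_le:
  assumes h: "0 \<le> h" "h \<le> 1"
  shows "norm (mexp (mat (- \<i> * \<zeta> * of_real h) ** sigma3) - (mat 1 + h *\<^sub>R (mat (- \<i> * \<zeta>) ** sigma3)))
    \<le> 4 * exp (norm \<zeta>) * norm \<zeta> ^ 2 * h ^ 2"
proof -
  define z where "z = - \<i> * \<zeta> * of_real h"
  have z: "norm z = norm \<zeta> * h" using h by (simp add: z_def norm_mult)
  have "exp (norm z) * norm z ^ 2 \<le> exp (norm \<zeta>) * (norm \<zeta> * h) ^ 2"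
    unfolding z using h by (intro mult_right_mono) (auto simp: mult_left_le)
  then have e: "norm (exp w - 1 - w) \<le> exp (norm \<zeta>) * (norm \<zeta> * h) ^ 2" if "w = z \<or> w = - z" for w
    using norm_exp_minus_1_minus_le[of w] that by auto
  have eq: "mexp (mat z ** sigma3) - (mat 1 + h *\<^sub>R (mat (- \<i> * \<zeta>) ** sigma3))
      = vector [vector [exp z - 1 - z, 0], vector [0, exp (- z) - 1 - (- z)]]"
    unfolding mexp_mat_mult_sigma3 unfolding mat_mult_sigma3
    by (rule matrix_2_eqI) (simp_all add: mat_def z_def scaleR_conv_of_real[where 'a = complex])
  have "norm (mexp (mat z ** sigma3) - (mat 1 + h *\<^sub>R (mat (- \<i> * \<zeta>) ** sigma3)))
      \<le> real CARD(2) * real CARD(2) * (exp (norm \<zeta>) * (norm \<zeta> * h) ^ 2)"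
  proof (rule norm_matrix_le_of_entries)
    fix i j
    show "norm ((mexp (mat z ** sigma3) - (mat 1 + h *\<^sub>R (mat (- \<i> * \<zeta>) ** sigma3))) $ i $ j)
        \<le> exp (norm \<zeta>) * (norm \<zeta> * h) ^ 2"
      unfolding eq using exhaust_2[of i] exhaust_2[of j] e[of z] e[of "- z"] by auto
  qed
  then show ?thesis by (simp add: z_def power_mult_distrib mult_ac)
qed

lemma norm_potential_matrix_le:
  assumes "norm (q t) \<le> e" "norm (r t) \<le> e"
  shows "norm (potential_matrix q r t) \<le> 4 * e"
proof -
  have "0 \<le> e" using assms(1) norm_ge_zero order_trans by blast
  have "norm (potential_matrix q r t) \<le> real CARD(2) * real CARD(2) * e"
  proof (rule norm_matrix_le_of_entries)
    fix i j show "norm (potential_matrix q r t $ i $ j) \<le> e"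
      using exhaust_2[of i] exhaust_2[of j] assms \<open>0 \<le> e\<close> by (auto simp: potential_matrix_def)
  qed
  then show ?thesis by simp
qed

context
  fixes q r :: "real \<Rightarrow> complex" and Q :: real and \<zeta> :: complex
  assumes q_le: "\<And>t. norm (q t) \<le> Q" and r_le: "\<And>t. norm (r t) \<le> Q"
begin

lemma norm_node_block_entry_le:
  assumes h: "0 \<le> h" "h \<le> 1" and c: "0 \<le> c" "c \<le> 1"
  shows "norm (node_block \<zeta> q r h t c $ i $ j) \<le> Q * exp (2 * norm \<zeta>) * h"
proof -
  have "0 \<le> Q" using q_le[of 0] by (meson norm_ge_zero order_trans)
  have "norm \<zeta> * (c * h) \<le> norm \<zeta> * 1"
    using h c by (intro mult_left_mono mult_le_one) auto
  then have w: "norm (2 * \<i> * \<zeta> * of_real (c * h)) \<le> 2 * norm \<zeta>"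
      "norm (- 2 * \<i> * \<zeta> * of_real (c * h)) \<le> 2 * norm \<zeta>"
    using h c by (simp_all add: norm_mult)
  have e: "norm (exp w) \<le> exp (2 * norm \<zeta>)" if "norm w \<le> 2 * norm \<zeta>" for w :: complex
    using that norm_exp[of w] by (meson exp_le_cancel_iff order_trans)
  have "norm (of_real h * f (t + c * h) * exp w) \<le> h * Q * exp (2 * norm \<zeta>)"
    if "norm w \<le> 2 * norm \<zeta>" "\<And>s. norm (f s) \<le> Q" for w and f :: "real \<Rightarrow> complex"
    unfolding norm_mult using h \<open>0 \<le> Q\<close> by (intro mult_mono e that) auto
  from this[OF w(1) q_le] this[OF w(2) r_le] show ?thesis
    using exhaust_2[of i] exhaust_2[of j] h \<open>0 \<le> Q\<close>
    by (auto simp: node_block_def mult_ac)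
qed

text \<open>The exponential factors in a node block differ from \<open>1\<close> by \<open>O(h)\<close>, and the block already carries a
  factor \<open>h\<close>; so to second order only the potential itself remains.\<close>

lemma norm_node_block_diff_le:
  assumes h: "0 \<le> h" "h \<le> 1" and c: "0 \<le> c" "c \<le> 1"
  shows "norm (node_block \<zeta> q r h t c - h *\<^sub>R potential_matrix q r (t + c * h))
    \<le> 8 * Q * norm \<zeta> * exp (2 * norm \<zeta>) * h ^ 2"
proof -
  have "0 \<le> Q" using q_le[of 0] by (meson norm_ge_zero order_trans)
  have ch: "c * h \<le> h" using h c by (simp add: mult_left_le_one_le)
  then have w: "norm (2 * \<i> * \<zeta> * of_real (c * h)) \<le> 2 * norm \<zeta> * h"
      "norm (- 2 * \<i> * \<zeta> * of_real (c * h)) \<le> 2 * norm \<zeta> * h"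
    using h c by (simp_all add: norm_mult mult_left_mono mult.assoc)
  have e: "norm (exp w - 1) \<le> exp (2 * norm \<zeta>) * (2 * norm \<zeta> * h)"
    if "norm w \<le> 2 * norm \<zeta> * h" for w :: complex
  proof -
    have "norm w \<le> 2 * norm \<zeta>"
      using that h mult_left_mono[of h 1 "2 * norm \<zeta>"] by simp
    then have "exp (norm w) * norm w \<le> exp (2 * norm \<zeta>) * (2 * norm \<zeta> * h)"
      using that by (intro mult_mono) auto
    with norm_exp_minus_1_le[of w] show ?thesis by simp
  qed
  have "norm (of_real h * f (t + c * h) * exp w - of_real h * f (t + c * h))
      \<le> h * Q * (exp (2 * norm \<zeta>) * (2 * norm \<zeta> * h))"
    if "norm w \<le> 2 * norm \<zeta> * h" "\<And>s. norm (f s) \<le> Q" for w and f :: "real \<Rightarrow> complex"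
  proof -
    have "of_real h * f (t + c * h) * exp w - of_real h * f (t + c * h)
        = of_real h * f (t + c * h) * (exp w - 1)"
      by (simp add: algebra_simps)
    then show ?thesis
      unfolding norm_mult using h \<open>0 \<le> Q\<close> by (simp only: norm_mult, intro mult_mono e that) auto
  qed
  note entries = this[OF w(1) q_le] this[OF w(2) r_le]
  have "norm (node_block \<zeta> q r h t c - h *\<^sub>R potential_matrix q r (t + c * h))
      \<le> real CARD(2) * real CARD(2) * (h * Q * (exp (2 * norm \<zeta>) * (2 * norm \<zeta> * h)))"
  proof (rule norm_matrix_le_of_entries)
    fix i j
    show "norm ((node_block \<zeta> q r h t c - h *\<^sub>R potential_matrix q r (t + c * h)) $ i $ j)
        \<le> h * Q * (exp (2 * norm \<zeta>) * (2 * norm \<zeta> * h))"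
      using entries exhaust_2[of i] exhaust_2[of j] h \<open>0 \<le> Q\<close>
      by (auto simp: node_block_def potential_matrix_def scaleR_conv_of_real[where 'a = complex])
  qed
  then show ?thesis by (simp add: power2_eq_square mult_ac)
qed

lemma norm_stage_matrix_le:
  fixes c :: "real^'s"
  assumes h: "0 \<le> h" "h \<le> 1" and c: "\<And>k. 0 \<le> c $ k" "\<And>k. c $ k \<le> 1"
  shows "norm (stage_matrix c \<zeta> q r h t)
    \<le> real CARD('s \<times> 2) * real CARD('s \<times> 2) * (Q * exp (2 * norm \<zeta>)) * h"
proof -
  have "0 \<le> Q" using q_le[of 0] by (meson norm_ge_zero order_trans)
  have "norm (stage_matrix c \<zeta> q r h t)
      \<le> real CARD('s \<times> 2) * real CARD('s \<times> 2) * (Q * exp (2 * norm \<zeta>) * h)"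
    by (rule norm_matrix_le_of_entries)
      (use norm_node_block_entry_le[OF h c] h \<open>0 \<le> Q\<close> in \<open>simp add: stage_matrix_def block_diag_def\<close>)
  then show ?thesis by (simp only: mult.assoc)
qed

end

lemma norm_unblock_le: "norm (unblock M) \<le> 4 * norm (M :: 'a::real_normed_vector^(1 \<times> 2)^(1 \<times> 2))"
proof -
  have "norm (unblock M) \<le> real CARD(2) * real CARD(2) * norm M"
    by (rule norm_matrix_le_of_entries) (simp add: unblock_def norm_matrix_entry_le)
  then show ?thesis by simp
qed

lemma sum_prod_UNIV: "(\<Sum>z\<in>UNIV. f z) = (\<Sum>x\<in>UNIV. \<Sum>y\<in>UNIV. f (x, y))"
  by (simp add: sum.cartesian_product)

text \<open>The leading term of \<open>h \<Lambda>\<close>, obtained by replacing the resolvent by the identity.\<close>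

lemma unblock_weighted_stages:
  fixes b :: "real^'s" and B :: "'s \<Rightarrow> complex^2^2"
  shows "unblock (kron (rowvector (cvec b)) sigma0 ** block_diag B ** kron (columnvector 1) sigma0)
    = (\<Sum>k\<in>UNIV. (b $ k) *\<^sub>R B k)"
proof -
  define L where "L = (kron (rowvector (cvec b)) sigma0 ** block_diag B :: complex^('s \<times> 2)^(1 \<times> 2))"
  have L: "L $ (1, i) $ (l, j) = complex_of_real (b $ l) * B l $ i $ j" for i l j
  proof -
    have "L $ (1, i) $ (l, j)
        = (\<Sum>k\<in>UNIV. \<Sum>i'\<in>UNIV. if k = l then (if i = i' then complex_of_real (b $ k) * B k $ i' $ j else 0) else 0)"
      unfolding L_def matrix_matrix_mult_def
      by (simp add: sum_prod_UNIV kron_def rowvector_def cvec_def sigma0_def mat_def block_diag_def)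
        (intro sum.cong refl, auto)
    also have "\<dots> = complex_of_real (b $ l) * B l $ i $ j"
    proof -
      have "(\<Sum>i'\<in>UNIV. if k = l then (if i = i' then complex_of_real (b $ k) * B k $ i' $ j else 0) else 0)
          = (if k = l then complex_of_real (b $ l) * B l $ i $ j else 0)" for k
        by auto
      then show ?thesis by simp
    qed
    finally show ?thesis .
  qed
  have "(L ** (kron (columnvector 1) sigma0 :: complex^(1 \<times> 2)^('s \<times> 2))) $ (1, i) $ (1, j)
      = (\<Sum>k\<in>UNIV. complex_of_real (b $ k) * B k $ i $ j)" for i j
  proof -
    have "(L ** (kron (columnvector 1) sigma0 :: complex^(1 \<times> 2)^('s \<times> 2))) $ (1, i) $ (1, j)
       = (\<Sum>k\<in>UNIV. \<Sum>j'\<in>UNIV. complex_of_real (b $ k) * B k $ i $ j' * (if j' = j then 1 else 0))"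
      by (simp add: matrix_matrix_mult_def[of L] sum_prod_UNIV L kron_def columnvector_def sigma0_def mat_def)
    then show ?thesis by (simp add: if_distrib cong: if_cong)
  qed
  then show ?thesis
    by (simp add: L_def[symmetric] unblock_def vec_eq_iff scaleR_conv_of_real[where 'a = complex])
qed

lemma unblock_diff: "unblock (M - N) = unblock M - unblock (N :: 'a::ab_group_add^(1 \<times> 2)^(1 \<times> 2))"
  by (simp add: unblock_def vec_eq_iff)

text \<open>With \<open>E\<close> the exponential factor, \<open>X = h \<Lambda>\<close> and \<open>S\<close> the weighted sum of potential matrices, the claim
  follows from \<open>E = 1 + h Z + O(h\<^sup>2)\<close> and \<open>X = h S + O(h\<^sup>2)\<close> by the identity
  \<open>E (1 + X) - (1 + h (Z + S)) = (E - 1 - h Z) (1 + X) + (1 + h Z) (X - h S) + h\<^sup>2 Z S\<close>.\<close>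

theorem one_step_matrix_expansion:
  fixes A :: "real^'s^'s" and b c :: "real^'s" and q r :: "real \<Rightarrow> complex"
  assumes q_le: "\<And>t. norm (q t) \<le> Q" and r_le: "\<And>t. norm (r t) \<le> Q"
    and c: "\<And>k. 0 \<le> c $ k" "\<And>k. c $ k \<le> 1"
  obtains C h0 where "0 \<le> C" "0 < h0"
    "\<And>h t. 0 < h \<Longrightarrow> h \<le> h0 \<Longrightarrow> invertible (resolvent_matrix A c \<zeta> q r h t)"
    "\<And>h t. 0 < h \<Longrightarrow> h \<le> h0 \<Longrightarrow>
      norm (mexp (mat (- \<i> * \<zeta> * of_real h) ** sigma3) ** (mat 1 + h *\<^sub>R Lambda A b c \<zeta> q r h t)
        - (mat 1 + h *\<^sub>R (mat (- \<i> * \<zeta>) ** sigma3 + (\<Sum>k\<in>UNIV. (b $ k) *\<^sub>R potential_matrix q r (t + c $ k * h)))))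
      \<le> C * h ^ 2"
proof -
  have "0 \<le> Q" using q_le[of 0] by (meson norm_ge_zero order_trans)
  define Z where "Z = mat (- \<i> * \<zeta>) ** sigma3"
  define S where "S h t = (\<Sum>k\<in>UNIV. (b $ k) *\<^sub>R potential_matrix q r (t + c $ k * h))" for h t
  define L where "L = (kron (rowvector (cvec b)) sigma0 :: complex^('s \<times> 2)^(1 \<times> 2))"
  define O1 where "O1 = (kron (columnvector 1) sigma0 :: complex^(1 \<times> 2)^('s \<times> 2))"
  define D where "D = stage_matrix c \<zeta> q r"
  define K where "K h t = kron (cmat A) sigma0 ** D h t" for h t
  define R where "R h t = matrix_inv (mat 1 - K h t)" for h t
  define I where "I = (mat 1 :: complex^('s \<times> 2)^('s \<times> 2))"
  define d where "d = real CARD('s \<times> 2) * real CARD('s \<times> 2) * (Q * exp (2 * norm \<zeta>))"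
  define \<alpha> where "\<alpha> = norm (kron (cmat A) sigma0)"
  define \<beta> where "\<beta> = (\<Sum>k\<in>UNIV. \<bar>b $ k\<bar>)"
  define e where "e = 8 * Q * norm \<zeta> * exp (2 * norm \<zeta>)"
  define C1 where "C1 = 4 * exp (norm \<zeta>) * norm \<zeta> ^ 2"
  define C2 where "C2 = 4 * (norm L * d * (2 * norm I * (\<alpha> * d)) * norm O1) + \<beta> * e"
  define n where "n = norm (mat 1 :: complex^2^2)"
  define \<sigma> where "\<sigma> = \<beta> * (4 * Q)"
  define C where "C = C1 * (n + (\<sigma> + C2)) + (n + norm Z) * C2 + norm Z * \<sigma>"
  \<comment> \<open>Chosen so that \<open>norm (K h t) \<le> \<alpha> d h \<le> 1/2\<close>; the summand \<open>1\<close> avoids a division by \<open>0\<close> for \<open>\<alpha> d = 0\<close>.\<close>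
  define h0 where "h0 = min 1 (1 / (2 * (\<alpha> * d + 1)))"
  have nonneg: "0 \<le> d" "0 \<le> \<alpha>" "0 \<le> \<beta>" "0 \<le> e" "0 \<le> C1" "0 \<le> n" "0 \<le> \<sigma>"
    using \<open>0 \<le> Q\<close> by (auto simp: d_def \<alpha>_def \<beta>_def e_def C1_def n_def \<sigma>_def intro!: sum_nonneg)
  then have "0 \<le> C2" by (simp add: C2_def)
  with nonneg have "0 \<le> C" by (simp add: C_def)
  have "0 \<le> \<alpha> * d" using nonneg by simp
  then have "0 < h0" by (simp add: h0_def)
  have D_le: "norm (D h t) \<le> d * h" if "0 < h" "h \<le> h0" for h t
    unfolding D_def d_def using that
    by (intro norm_stage_matrix_le q_le r_le c) (auto simp: h0_def)
  have K_le: "norm (K h t) \<le> \<alpha> * d * h" if "0 < h" "h \<le> h0" for h t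
  proof -
    have "norm (K h t) \<le> \<alpha> * norm (D h t)"
      unfolding K_def \<alpha>_def by (rule norm_matrix_mult_le)
    also have "\<dots> \<le> \<alpha> * (d * h)" using D_le[OF that] nonneg by (intro mult_left_mono)
    finally show ?thesis by (simp add: mult.assoc)
  qed
  have K_half: "norm (K h t) \<le> 1/2" if "0 < h" "h \<le> h0" for h t
  proof -
    have "\<alpha> * d * h \<le> (\<alpha> * d + 1) * h" using that by simp
    also have "\<dots> \<le> (\<alpha> * d + 1) * (1 / (2 * (\<alpha> * d + 1)))"
      using that \<open>0 \<le> \<alpha> * d\<close> by (intro mult_left_mono) (auto simp: h0_def)
    also have "\<dots> = 1/2" using \<open>0 \<le> \<alpha> * d\<close> by (simp add: field_simps)
    finally show ?thesis using K_le[OF that, of t] by simp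
  qed
  have S_le: "norm (S h t) \<le> \<sigma>" for h t
    unfolding S_def \<sigma>_def \<beta>_def sum_distrib_right
    by (intro order_trans[OF norm_sum] sum_mono) (simp add: mult_left_mono norm_potential_matrix_le q_le r_le)
  have Lambda_le: "norm (h *\<^sub>R Lambda A b c \<zeta> q r h t - h *\<^sub>R S h t) \<le> C2 * h ^ 2"
    if h: "0 < h" "h \<le> h0" for h t
  proof -
    \<comment> \<open>Two replacements, each of second order: the resolvent by the identity, then node blocks by potentials.\<close>
    define T where "T = (\<Sum>k\<in>UNIV. (b $ k) *\<^sub>R node_block \<zeta> q r h t (c $ k))"
    have h1: "0 \<le> h" "h \<le> 1" using h by (auto simp: h0_def)
    have "h *\<^sub>R Lambda A b c \<zeta> q r h t = unblock (L ** D h t ** R h t ** O1)"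
      using h by (simp add: Lambda_def L_def D_def R_def K_def O1_def resolvent_matrix_def)
    moreover have "T = unblock (L ** D h t ** O1)"
      by (simp add: T_def L_def D_def O1_def stage_matrix_def unblock_weighted_stages)
    ultimately have "h *\<^sub>R Lambda A b c \<zeta> q r h t - T = unblock (L ** D h t ** (R h t - I) ** O1)"
      by (simp add: unblock_diff[symmetric] matrix_mult_diff_left matrix_mult_diff_right I_def)
    moreover have "norm (L ** D h t ** (R h t - I) ** O1)
        \<le> norm L * (d * h) * (2 * norm I * (\<alpha> * d * h)) * norm O1"
    proof -
      have "norm (R h t - I) \<le> 2 * norm I * (\<alpha> * d * h)"
        using norm_matrix_inv_mat_1_diff_le[OF K_half[OF h, of t]] K_le[OF h, of t]
        unfolding R_def I_def by (meson mult_left_mono mult_nonneg_nonneg norm_ge_zero order_trans zero_le_numeral)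
      moreover have "norm (L ** D h t) \<le> norm L * (d * h)"
        using norm_matrix_mult_le[of L "D h t"] D_le[OF h, of t]
        by (meson mult_left_mono norm_ge_zero order_trans)
      ultimately have "norm (L ** D h t) * norm (R h t - I) \<le> norm L * (d * h) * (2 * norm I * (\<alpha> * d * h))"
        using nonneg h by (intro mult_mono) auto
      then have "norm (L ** D h t ** (R h t - I)) \<le> norm L * (d * h) * (2 * norm I * (\<alpha> * d * h))"
        using norm_matrix_mult_le[of "L ** D h t" "R h t - I"] by linarith
      then show ?thesis
        using norm_matrix_mult_le[of "L ** D h t ** (R h t - I)" O1]
        by (meson mult_right_mono norm_ge_zero order_trans)
    qed
    ultimately have "norm (h *\<^sub>R Lambda A b c \<zeta> q r h t - T)
        \<le> 4 * (norm L * (d * h) * (2 * norm I * (\<alpha> * d * h)) * norm O1)"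
      using norm_unblock_le[of "L ** D h t ** (R h t - I) ** O1"] by simp
    moreover have "norm (T - h *\<^sub>R S h t) \<le> \<beta> * (e * h ^ 2)"
    proof -
      have "T - h *\<^sub>R S h t = (\<Sum>k\<in>UNIV. (b $ k) *\<^sub>R
          (node_block \<zeta> q r h t (c $ k) - h *\<^sub>R potential_matrix q r (t + c $ k * h)))"
        by (simp add: T_def S_def scaleR_sum_right sum_subtractf scaleR_diff_right mult.commute)
      also have "norm \<dots> \<le> (\<Sum>k\<in>UNIV. \<bar>b $ k\<bar> * (e * h ^ 2))"
        unfolding e_def using norm_node_block_diff_le[OF q_le r_le h1 c]
        by (intro order_trans[OF norm_sum] sum_mono) (simp add: mult_left_mono)
      finally show ?thesis by (simp add: \<beta>_def sum_distrib_right)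
    qed
    ultimately have "norm (h *\<^sub>R Lambda A b c \<zeta> q r h t - h *\<^sub>R S h t)
        \<le> 4 * (norm L * (d * h) * (2 * norm I * (\<alpha> * d * h)) * norm O1) + \<beta> * (e * h ^ 2)"
      by (rule norm_diff_triangle_le)
    then show ?thesis by (simp add: C2_def algebra_simps power2_eq_square)
  qed
  show thesis
  proof (rule that[OF \<open>0 \<le> C\<close> \<open>0 < h0\<close>])
    fix h t :: real assume h: "0 < h" "h \<le> h0"
    then have h1: "0 \<le> h" "h \<le> 1" by (auto simp: h0_def)
    show "invertible (resolvent_matrix A c \<zeta> q r h t)"
      using invertible_mat_1_diff[of "K h t"] K_half[OF h, of t]
      by (simp add: resolvent_matrix_def K_def D_def)
    define E where "E = mexp (mat (- \<i> * \<zeta> * of_real h) ** sigma3)"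
    define X where "X = h *\<^sub>R Lambda A b c \<zeta> q r h t"
    have h2: "h ^ 2 \<le> 1" using h1 by (simp add: power_le_one)
    have X: "norm (X - h *\<^sub>R S h t) \<le> C2 * h ^ 2" unfolding X_def by (rule Lambda_le[OF h])
    have E: "norm (E - (mat 1 + h *\<^sub>R Z)) \<le> C1 * h ^ 2"
      unfolding E_def Z_def C1_def by (rule norm_mexp_linearization_le[OF h1])
    have "norm (h *\<^sub>R S h t) \<le> 1 * \<sigma>"
      using h1 S_le[of h t] nonneg by (simp only: norm_scaleR, intro mult_mono) auto
    moreover have "C2 * h ^ 2 \<le> C2 * 1" using h2 \<open>0 \<le> C2\<close> by (intro mult_left_mono)
    ultimately have "norm X \<le> \<sigma> + C2"
      using X norm_triangle_sub[of X "h *\<^sub>R S h t"] by simp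
    then have 1: "norm (mat 1 + X) \<le> n + (\<sigma> + C2)"
      using norm_triangle_ineq[of "mat 1" X] by (simp add: n_def)
    have "norm (h *\<^sub>R Z) \<le> 1 * norm Z"
      using h1 by (simp only: norm_scaleR, intro mult_mono) auto
    then have 2: "norm (mat 1 + h *\<^sub>R Z) \<le> n + norm Z"
      using norm_triangle_ineq[of "mat 1" "h *\<^sub>R Z"] by (simp add: n_def)
    have "E ** (mat 1 + X) - (mat 1 + h *\<^sub>R (Z + S h t))
        = (E - (mat 1 + h *\<^sub>R Z)) ** (mat 1 + X) + (mat 1 + h *\<^sub>R Z) ** (X - h *\<^sub>R S h t) + (h ^ 2) *\<^sub>R (Z ** S h t)"
      by (simp add: matrix_mult_diff_left matrix_mult_diff_right matrix_mult_add_left matrix_add_ldistrib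
          matrix_mult_scaleR_left matrix_mult_scaleR_right scaleR_add_right power2_eq_square)
    moreover have "norm ((E - (mat 1 + h *\<^sub>R Z)) ** (mat 1 + X)) \<le> C1 * h ^ 2 * (n + (\<sigma> + C2))"
      using nonneg by (intro order_trans[OF norm_matrix_mult_le] mult_mono E 1) auto
    moreover have "norm ((mat 1 + h *\<^sub>R Z) ** (X - h *\<^sub>R S h t)) \<le> (n + norm Z) * (C2 * h ^ 2)"
      using nonneg by (intro order_trans[OF norm_matrix_mult_le] mult_mono X 2) auto
    moreover have "norm ((h ^ 2) *\<^sub>R (Z ** S h t)) \<le> h ^ 2 * (norm Z * \<sigma>)"
    proof -
      have "norm (Z ** S h t) \<le> norm Z * \<sigma>"
        using norm_matrix_mult_le[of Z "S h t"] S_le[of h t] by (meson mult_left_mono norm_ge_zero order_trans)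
      then show ?thesis by (simp add: mult_left_mono)
    qed
    ultimately have "norm (E ** (mat 1 + X) - (mat 1 + h *\<^sub>R (Z + S h t)))
        \<le> C1 * h ^ 2 * (n + (\<sigma> + C2)) + (n + norm Z) * (C2 * h ^ 2) + h ^ 2 * (norm Z * \<sigma>)"
      by (smt (verit) norm_triangle_ineq)
    also have "\<dots> = C * h ^ 2" by (simp add: C_def algebra_simps)
    finally show "norm (mexp (mat (- \<i> * \<zeta> * of_real h) ** sigma3) ** (mat 1 + h *\<^sub>R Lambda A b c \<zeta> q r h t)
        - (mat 1 + h *\<^sub>R (mat (- \<i> * \<zeta>) ** sigma3 + (\<Sum>k\<in>UNIV. (b $ k) *\<^sub>R potential_matrix q r (t + c $ k * h)))))
      \<le> C * h ^ 2"
      by (simp only: E_def X_def Z_def S_def)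
  qed
qed

section \<open>Convergence\<close>

lemma potential_matrix_diff:
  "potential_matrix q r s - potential_matrix q r t = potential_matrix (\<lambda>_. q s - q t) (\<lambda>_. r s - r t) 0"
  unfolding potential_matrix_def by (rule matrix_2_eqI) simp_all

lemma isCont_zs_matrix:
  assumes "isCont q t" "isCont r t"
  shows "isCont (zs_matrix \<zeta> q r) t"
proof -
  have "isCont (potential_matrix q r) t"
    unfolding isCont_def
  proof (intro vec_tendstoI)
    fix i j
    show "((\<lambda>s. potential_matrix q r s $ i $ j) \<longlongrightarrow> potential_matrix q r t $ i $ j) (at t)"
      using exhaust_2[of i] exhaust_2[of j] assms by (auto simp: potential_matrix_def isCont_def)
  qed
  then show ?thesis
    unfolding zs_matrix_def[abs_def] by (intro isCont_add) auto
qed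

text \<open>Let \<open>e\<^sub>n\<close> be the error after \<open>n\<close> steps. Applying the step matrix to \<open>e\<^sub>n\<close> multiplies its norm by at most
  \<open>1 + h (\<mu> + C)\<close>, and each step adds a defect of \<open>O(h (osc\<^sub>n + h))\<close>. Gronwall sums the defects with a
  factor \<open>exp ((T2 - T1) (\<mu> + C))\<close> that does not depend on the number of steps.
  By \<open>r_diff\<close> the oscillation of \<open>q\<close> controls that of the whole potential matrix.\<close>

theorem numerical_solution_error_tendsto_0:
  fixes A :: "real^'s^'s" and b c :: "real^'s" and q r :: "real \<Rightarrow> complex"
  assumes q_le: "\<And>t. norm (q t) \<le> Q" and r_le: "\<And>t. norm (r t) \<le> Q"
    and r_diff: "\<And>s t. norm (r s - r t) \<le> norm (q s - q t)"
    and q_cont: "AE t in lebesgue. isCont q t"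
    and c: "\<And>k. 0 \<le> c $ k" "\<And>k. c $ k \<le> 1" and weights: "(\<Sum>k\<in>UNIV. b $ k) = 1"
    and T: "T1 < T2" and sol: "zs_solution \<zeta> q r T1 T2 v0 v"
  shows "(\<lambda>N. Max ((\<lambda>n. norm (numerical_solution A b c \<zeta> q r T1 ((T2 - T1) / real N) v0 n
      - v (T1 + real n * ((T2 - T1) / real N)))) ` {0..N})) \<longlonglongrightarrow> 0"
proof -
  have ac: "absolutely_continuous_on T1 T2 v" and v0: "v T1 = v0"
    and der: "AE t in lebesgue. t \<in> {T1..T2} \<longrightarrow>
      (v has_vector_derivative (zs_matrix \<zeta> q r t *v v t)) (at t within {T1..T2})"
    using sol by (auto simp: zs_solution_def)
  have "0 \<le> Q" using q_le[of 0] norm_ge_zero order_trans by blast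
  obtain C h0 where "0 \<le> C" "0 < h0" and step_matrix: "\<And>h t. 0 < h \<Longrightarrow> h \<le> h0 \<Longrightarrow>
      norm (mexp (mat (- \<i> * \<zeta> * of_real h) ** sigma3) ** (mat 1 + h *\<^sub>R Lambda A b c \<zeta> q r h t)
        - (mat 1 + h *\<^sub>R (mat (- \<i> * \<zeta>) ** sigma3 + (\<Sum>k\<in>UNIV. (b $ k) *\<^sub>R potential_matrix q r (t + c $ k * h)))))
      \<le> C * h ^ 2"
    by (rule one_step_matrix_expansion[OF q_le r_le c, where A = A and b = b and \<zeta> = \<zeta>]) (rule that)
  obtain V where V: "\<And>t. t \<in> {T1..T2} \<Longrightarrow> norm (v t) \<le> V"
  proof -
    have "bounded (v ` {T1..T2})"
      using absolutely_continuous_on_imp_continuous_on[OF ac]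
      by (intro compact_imp_bounded compact_continuous_image) auto
    then show thesis using that unfolding bounded_iff by blast
  qed
  have "0 \<le> V" using order_trans[OF norm_ge_zero V[of T1]] T by simp
  define Z where "Z = mat (- \<i> * \<zeta>) ** sigma3"
  define S where "S h t = (\<Sum>k\<in>UNIV. (b $ k) *\<^sub>R potential_matrix q r (t + c $ k * h))" for h t
  define \<beta> where "\<beta> = (\<Sum>k\<in>UNIV. \<bar>b $ k\<bar>)"
  define m where "m = norm Z + 4 * Q"
  define \<mu> where "\<mu> = norm Z + \<beta> * (4 * Q)"
  have "0 \<le> \<beta>" by (simp add: \<beta>_def sum_nonneg)
  with \<open>0 \<le> Q\<close> have "0 \<le> m" "0 \<le> \<mu>" by (simp_all add: m_def \<mu>_def)
  have m: "norm (zs_matrix \<zeta> q r t) \<le> m" for t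
    unfolding zs_matrix_def Z_def[symmetric] m_def
    using norm_triangle_ineq[of Z "potential_matrix q r t"] norm_potential_matrix_le[of q t Q r, OF q_le r_le] by simp
  have \<mu>: "norm (Z + S h t) \<le> \<mu>" for h t
  proof -
    have "norm (S h t) \<le> \<beta> * (4 * Q)"
      unfolding S_def \<beta>_def sum_distrib_right
      by (intro order_trans[OF norm_sum] sum_mono)
        (simp add: mult_left_mono norm_potential_matrix_le q_le r_le)
    then show ?thesis using norm_triangle_ineq[of Z "S h t"] by (simp add: \<mu>_def)
  qed
  define h where "h N = (T2 - T1) / real N" for N
  define x where "x N n = T1 + real n * h N" for N n
  define D where "D N n = diameter (q ` {x N n..x N (Suc n)})" for N n
  define err where "err N n = norm (numerical_solution A b c \<zeta> q r T1 (h N) v0 n - v (x N n))" for N n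
  define defect where "defect N n = C * h N ^ 2 * V + (\<beta> * (4 * D N n) * V + \<mu> * (m * V * h N)) * h N" for N n
  have q_bdd: "bounded (q ` X)" for X
    unfolding bounded_iff using q_le by blast
  have D_nonneg: "0 \<le> D N n" for N n
    unfolding D_def by (rule diameter_ge_0[OF q_bdd])
  have x_Suc: "x N (Suc n) = x N n + h N" for N n
    by (simp add: x_def algebra_simps)
  have x_range: "T1 \<le> x N n" "x N n \<le> T2" if "n \<le> N" "0 < N" for N n
  proof -
    show "T1 \<le> x N n" using T by (simp add: x_def h_def)
    have "real n * h N \<le> real N * h N" using that T by (intro mult_right_mono) (auto simp: h_def)
    then show "x N n \<le> T2" using that by (simp add: x_def h_def)
  qed
  have consistency: "norm (v (x N (Suc n)) - (v (x N n) + h N *\<^sub>R ((Z + S (h N) (x N n)) *v v (x N n))))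
      \<le> (\<beta> * (4 * D N n) * V + \<mu> * (m * V * h N)) * h N" if n: "n < N" for N n
  proof -
    have "0 < h N" using n T by (simp add: h_def)
    \<comment> \<open>The normalisation of the weights enters here: it lets \<open>U(t)\<close> be pulled under the weighted sum.\<close>
    have \<omega>: "norm (zs_matrix \<zeta> q r t - (Z + S (h N) (x N n))) \<le> \<beta> * (4 * D N n)"
      if t: "t \<in> {x N n..x N (Suc n)}" for t
    proof -
      have "zs_matrix \<zeta> q r t - (Z + S (h N) (x N n))
          = (\<Sum>k\<in>UNIV. b $ k) *\<^sub>R potential_matrix q r t - S (h N) (x N n)"
        by (simp add: zs_matrix_def Z_def weights)
      also have "\<dots> = (\<Sum>k\<in>UNIV. (b $ k) *\<^sub>R
          (potential_matrix q r t - potential_matrix q r (x N n + c $ k * h N)))"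
        by (simp add: S_def scaleR_sum_left scaleR_diff_right sum_subtractf)
      also have "norm \<dots> \<le> (\<Sum>k\<in>UNIV. \<bar>b $ k\<bar> * (4 * D N n))"
      proof (intro order_trans[OF norm_sum] sum_mono)
        fix k
        have "c $ k * h N \<le> 1 * h N" using c(2)[of k] \<open>0 < h N\<close> by (intro mult_right_mono) auto
        then have "x N n + c $ k * h N \<in> {x N n..x N (Suc n)}"
          using c(1)[of k] \<open>0 < h N\<close> by (simp add: x_Suc)
        with t have qd: "norm (q t - q (x N n + c $ k * h N)) \<le> D N n"
          unfolding D_def dist_norm[symmetric] by (intro diameter_bounded_bound q_bdd) auto
        then have "norm (potential_matrix q r t - potential_matrix q r (x N n + c $ k * h N)) \<le> 4 * D N n"
          unfolding potential_matrix_diff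
          using order_trans[OF r_diff qd] by (intro norm_potential_matrix_le)
        then show "norm ((b $ k) *\<^sub>R (potential_matrix q r t - potential_matrix q r (x N n + c $ k * h N)))
            \<le> \<bar>b $ k\<bar> * (4 * D N n)"
          by (simp add: mult_left_mono)
      qed
      finally show ?thesis by (simp add: \<beta>_def sum_distrib_right)
    qed
    have "norm (v (x N (Suc n)) - (v (x N n) + (x N (Suc n) - x N n) *\<^sub>R ((Z + S (h N) (x N n)) *v v (x N n))))
        \<le> (\<beta> * (4 * D N n) * V + norm (Z + S (h N) (x N n)) * (m * V * (x N (Suc n) - x N n))) * (x N (Suc n) - x N n)"
      using x_range[of n N] x_range[of "Suc n" N] n \<open>0 < h N\<close>
      by (intro caratheodory_linear_step[OF ac der V m] \<omega>) (auto simp: x_Suc)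
    also have "\<dots> \<le> (\<beta> * (4 * D N n) * V + \<mu> * (m * V * (x N (Suc n) - x N n))) * (x N (Suc n) - x N n)"
      using \<open>0 < h N\<close> \<open>0 \<le> m\<close> \<open>0 \<le> V\<close>
      by (intro mult_right_mono add_left_mono \<mu>) (auto simp: x_Suc)
    finally show ?thesis by (simp add: x_Suc)
  qed
  have err_step: "err N (Suc n) \<le> (1 + h N * (\<mu> + C)) * err N n + defect N n"
    if n: "n < N" and hN: "h N \<le> h0" "h N \<le> 1" for N n
  proof -
    have "0 < h N" using n T by (simp add: h_def)
    define w where "w = numerical_solution A b c \<zeta> q r T1 (h N) v0 n"
    define u where "u = v (x N n)"
    define P where "P = Z + S (h N) (x N n)"
    define G where "G = mexp (mat (- \<i> * \<zeta> * of_real (h N)) ** sigma3) ** (mat 1 + h N *\<^sub>R Lambda A b c \<zeta> q r (h N) (x N n))"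
    define R where "R = G - (mat 1 + h N *\<^sub>R P)"
    have R: "norm R \<le> C * h N ^ 2"
      unfolding R_def G_def P_def Z_def S_def by (rule step_matrix[OF \<open>0 < h N\<close> hN(1)])
    have u: "norm u \<le> V" unfolding u_def using x_range[of n N] n by (intro V) auto
    have "numerical_solution A b c \<zeta> q r T1 (h N) v0 (Suc n) = G *v w"
      by (simp add: G_def w_def x_def Let_def matrix_vector_mul_assoc[symmetric]
          matrix_vector_mult_add_rdistrib matrix_vector_mult_scaleR_left)
    then have "numerical_solution A b c \<zeta> q r T1 (h N) v0 (Suc n) - v (x N (Suc n))
        = (w - u) + h N *\<^sub>R (P *v (w - u)) + R *v (w - u) + R *v u
          - (v (x N (Suc n)) - (u + h N *\<^sub>R (P *v u)))"
      by (simp add: R_def matrix_vector_mult_add_rdistrib matrix_vector_mult_diff_rdistrib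
          matrix_vector_mult_diff_distrib matrix_vector_mult_scaleR_left scaleR_diff_right)
    then have "err N (Suc n) \<le> norm (w - u) + norm (h N *\<^sub>R (P *v (w - u))) + norm (R *v (w - u)) + norm (R *v u)
          + norm (v (x N (Suc n)) - (u + h N *\<^sub>R (P *v u)))"
      unfolding err_def by (smt (verit) norm_triangle_ineq norm_triangle_ineq4)
    moreover have "norm (h N *\<^sub>R (P *v (w - u))) \<le> h N * (\<mu> * norm (w - u))"
    proof -
      have "norm (P *v (w - u)) \<le> \<mu> * norm (w - u)"
        unfolding P_def by (intro order_trans[OF norm_matrix_vector_mult_le] mult_right_mono \<mu>) simp
      then show ?thesis using \<open>0 < h N\<close> by (simp add: mult_left_mono)
    qed
    moreover have "norm (R *v (w - u)) \<le> h N * C * norm (w - u)"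
    proof -
      have "C * h N ^ 2 \<le> h N * C"
        using hN \<open>0 < h N\<close> \<open>0 \<le> C\<close> mult_left_mono[of "h N" 1 "h N * C"] by (simp add: power2_eq_square mult_ac)
      with R have "norm R \<le> h N * C" by simp
      then show ?thesis
        using norm_matrix_vector_mult_le[of R "w - u"] by (meson mult_right_mono norm_ge_zero order_trans)
    qed
    moreover have "norm (R *v u) \<le> C * h N ^ 2 * V"
      using R u \<open>0 \<le> C\<close> by (intro order_trans[OF norm_matrix_vector_mult_le] mult_mono) auto
    moreover have "norm (v (x N (Suc n)) - (u + h N *\<^sub>R (P *v u)))
        \<le> (\<beta> * (4 * D N n) * V + \<mu> * (m * V * h N)) * h N"
      unfolding u_def P_def by (rule consistency[OF n])
    ultimately have "err N (Suc n) \<le> norm (w - u) + h N * (\<mu> * norm (w - u)) + h N * C * norm (w - u) + defect N n"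
      unfolding defect_def by linarith
    also have "\<dots> = (1 + h N * (\<mu> + C)) * norm (w - u) + defect N n"
      by (simp add: algebra_simps)
    finally show ?thesis by (simp add: err_def w_def u_def)
  qed
  define osc where "osc N = h N * (\<Sum>n<N. D N n)" for N
  define bound where "bound N = exp ((T2 - T1) * (\<mu> + C)) *
      (4 * \<beta> * V * osc N + (T2 - T1) * (C * V + \<mu> * m * V) * h N)" for N
  have err_le: "err N n \<le> bound N" if N: "0 < N" "h N \<le> h0" "h N \<le> 1" and "n \<le> N" for N n
  proof -
    have Nh: "real N * h N = T2 - T1" "0 < h N" using N T by (simp_all add: h_def)
    have "err N n \<le> exp (real N * (h N * (\<mu> + C))) * (\<Sum>j<N. defect N j)"
    proof (rule discrete_gronwall[OF _ _ _ _ \<open>n \<le> N\<close>])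
      show "err N 0 = 0" by (simp add: err_def x_def v0)
      show "0 \<le> defect N j" for j
        using Nh D_nonneg[of N j] \<open>0 \<le> C\<close> \<open>0 \<le> V\<close> \<open>0 \<le> \<beta>\<close> \<open>0 \<le> \<mu>\<close> \<open>0 \<le> m\<close> by (simp add: defect_def)
    qed (use Nh N err_step \<open>0 \<le> C\<close> \<open>0 \<le> \<mu>\<close> in auto)
    also have "(\<Sum>j<N. defect N j) = (\<Sum>j<N. 4 * \<beta> * V * h N * D N j + (C * V + \<mu> * m * V) * h N * h N)"
      by (intro sum.cong refl) (simp add: defect_def algebra_simps power2_eq_square)
    also have "\<dots> = 4 * \<beta> * V * osc N + real N * ((C * V + \<mu> * m * V) * h N * h N)"
      by (simp add: sum.distrib sum_distrib_left osc_def mult.assoc)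
    also have "real N * ((C * V + \<mu> * m * V) * h N * h N) = (real N * h N) * (C * V + \<mu> * m * V) * h N"
      by (simp add: mult_ac)
    also have "real N * (h N * (\<mu> + C)) = (real N * h N) * (\<mu> + C)" by simp
    finally show ?thesis by (simp only: Nh bound_def)
  qed
  have h_lim: "h \<longlonglongrightarrow> 0"
    unfolding h_def[abs_def] by (rule lim_const_over_n)
  have "osc \<longlonglongrightarrow> 0"
    using riemann_oscillation_sum_tendsto_0[OF T q_bdd q_cont]
    by (simp add: osc_def[abs_def] D_def x_def h_def)
  then have "bound \<longlonglongrightarrow> exp ((T2 - T1) * (\<mu> + C)) * (4 * \<beta> * V * 0 + (T2 - T1) * (C * V + \<mu> * m * V) * 0)"
    unfolding bound_def[abs_def] by (intro tendsto_intros h_lim)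
  then have bound_lim: "bound \<longlonglongrightarrow> 0" by simp
  have "\<forall>\<^sub>F N in sequentially. h N < min h0 1"
    using h_lim \<open>0 < h0\<close> by (intro order_tendstoD) auto
  then have small: "\<forall>\<^sub>F N in sequentially. 0 < N \<and> h N \<le> h0 \<and> h N \<le> 1"
    using eventually_gt_at_top[of 0] by eventually_elim auto
  have "(\<lambda>N. Max (err N ` {0..N})) \<longlonglongrightarrow> 0"
  proof (rule real_tendsto_sandwich[OF _ _ tendsto_const bound_lim])
    show "\<forall>\<^sub>F N in sequentially. 0 \<le> Max (err N ` {0..N})"
      by (intro always_eventually allI) (auto simp: Max_ge_iff err_def)
    show "\<forall>\<^sub>F N in sequentially. Max (err N ` {0..N}) \<le> bound N"
      using small by eventually_elim (auto intro: err_le)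
  qed
  then show ?thesis by (simp add: err_def[abs_def] x_def h_def)
qed

theorem proposition2p6:
  fixes A :: "((real, 's::{finite,linorder}) vec, 's::{finite,linorder}) vec"
    and b c :: "(real, 's::{finite,linorder}) vec"
    and q r :: "real \<Rightarrow> complex"
    and \<kappa> T1 T2 :: real
    and \<zeta> :: complex
  assumes support_compact: "compact (function_support q)"
    and q_bounded: "bounded (q ` function_support q)"
    and q_ae_continuous: "AE t in lebesgue. isCont q t"
    and kappa: "\<kappa> \<in> {1, -1}"
    and r_def: "\<And>t. r t = of_real \<kappa> * cnj (q t)"
    and nodes: "\<And>k. 0 \<le> c $ k" "\<And>k. c $ k \<le> 1" "\<And>j k. j \<le> k \<Longrightarrow> c $ j \<le> c $ k"
    and weights: "(\<Sum>j\<in>UNIV. b $ j) = 1"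
    and interval: "T1 < T2" "function_support q \<subseteq> {T1..T2}"
  shows "method_convergent A b c \<zeta> q r T1 T2"
proof -
  obtain B where B: "\<And>t. t \<in> function_support q \<Longrightarrow> norm (q t) \<le> B"
    using q_bounded unfolding bounded_iff by blast
  define Q where "Q = max B 0"
  have q_le: "norm (q t) \<le> Q" for t
  proof (cases "q t = 0")
    case False
    then have "t \<in> function_support q"
      unfolding function_support_def by (intro subsetD[OF closure_subset]) simp
    then show ?thesis using B[of t] by (simp add: Q_def)
  qed (simp add: Q_def)
  have r_diff: "norm (r s - r t) = norm (q s - q t)" for s t
  proof -
    have "r s - r t = of_real \<kappa> * cnj (q s - q t)" by (simp add: r_def algebra_simps)
    then show ?thesis using kappa by (auto simp: norm_mult complex_mod_cnj simp del: complex_cnj_diff)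
  qed
  have r_le: "norm (r t) \<le> Q" for t
    using q_le[of t] kappa by (auto simp: r_def norm_mult)
  define m where "m = norm (mat (- \<i> * \<zeta>) ** sigma3) + 4 * Q"
  have m: "norm (zs_matrix \<zeta> q r t) \<le> m" for t
    unfolding zs_matrix_def m_def
    using norm_triangle_ineq[of "mat (- \<i> * \<zeta>) ** sigma3" "potential_matrix q r t"]
      norm_potential_matrix_le[of q t Q r, OF q_le r_le] by simp
  obtain h0 where "0 < h0" and inv: "\<And>h t. 0 < h \<Longrightarrow> h \<le> h0 \<Longrightarrow> invertible (resolvent_matrix A c \<zeta> q r h t)"
    by (rule one_step_matrix_expansion[OF q_le r_le nodes(1,2), where A = A and b = b and \<zeta> = \<zeta>]) (rule that)
  have "(\<lambda>N. (T2 - T1) / real N) \<longlonglongrightarrow> 0" by (rule lim_const_over_n)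
  then have "\<forall>\<^sub>F N in sequentially. (T2 - T1) / real N < h0"
    using \<open>0 < h0\<close> by (rule order_tendstoD)
  then have well_defined: "\<forall>\<^sub>F N in sequentially. method_well_defined A c \<zeta> q r T1 ((T2 - T1) / real N) N"
    by eventually_elim (use interval(1) in \<open>auto simp: method_well_defined_def intro!: inv\<close>)
  have existence: "\<exists>v. zs_solution \<zeta> q r T1 T2 v0 v" for v0
  proof -
    have lip: "norm (zs_matrix \<zeta> q r t *v x - zs_matrix \<zeta> q r t *v y) \<le> (\<bar>m\<bar> + 1) * norm (x - y)" for t x y
    proof -
      have "norm (zs_matrix \<zeta> q r t *v (x - y)) \<le> norm (zs_matrix \<zeta> q r t) * norm (x - y)"
        by (rule norm_matrix_vector_mult_le)
      also have "\<dots> \<le> (\<bar>m\<bar> + 1) * norm (x - y)"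
        using m[of t] by (intro mult_right_mono) auto
      finally show ?thesis by (simp add: matrix_vector_mult_diff_distrib)
    qed
    have cont: "AE t in lebesgue. \<forall>x. isCont (\<lambda>s. zs_matrix \<zeta> q r s *v x) t"
      using q_ae_continuous
    proof eventually_elim
      case (elim t)
      then have "isCont r t" unfolding r_def[abs_def] by (intro continuous_intros)
      with elim have "isCont (zs_matrix \<zeta> q r) t" by (rule isCont_zs_matrix)
      then show ?case
        unfolding isCont_def
        by (intro allI bounded_bilinear.tendsto[OF bounded_bilinear_matrix_vector_mult] tendsto_const)
    qed
    obtain v where "v T1 = v0" "absolutely_continuous_on T1 T2 v"
      "AE t in lebesgue. t \<in> {T1..T2} \<longrightarrow>
        (v has_vector_derivative (zs_matrix \<zeta> q r t *v v t)) (at t within {T1..T2})"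
      by (rule caratheodory_solution_exists[OF less_imp_le[OF interval(1)] _ lip _ cont,
            where B = 0 and ?x0.0 = v0]) (simp, simp, rule that)
    then show ?thesis unfolding zs_solution_def by blast
  qed
  have convergence: "(\<lambda>N. let h = (T2 - T1) / real N in
      Max ((\<lambda>n. norm (numerical_solution A b c \<zeta> q r T1 h v0 n - v (T1 + real n * h))) ` {0..N})) \<longlonglongrightarrow> 0"
    if "zs_solution \<zeta> q r T1 T2 v0 v" for v0 v
    unfolding Let_def
    using q_le r_le eq_refl[OF r_diff] q_ae_continuous nodes(1,2) weights interval(1) that
    by (rule numerical_solution_error_tendsto_0)
  show ?thesis
    unfolding method_convergent_def using well_defined existence convergence by blast
qed

end
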